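(* Let $n\ge2$, let $\lambda=(\lambda_1\ge\cdots\ge\lambda_{n-1}\ge0)$ be a partition, $\rho=(n-1,\ldots,1)$, $\mu=\lambda+\rho$, $m=\mu_1$, and let $\sigma$ be a semistandard Young tableau of shape $\mu$ with entries in $[n]$. Let $\widehat T=\widehat C_1\cdots\widehat C_m$ be its root filling. If for every $i=2,\ldots,m$ the pair $(\widehat C_{i-1},\widehat C_i)$ satisfies the Non-overlapping Condition, then \[ \sum_{T\in\mathrm{sort}^{-1}(\sigma)}(-1)^{\ell(T[1])}t^{\mathrm{inv}(T)}(1-t)^{\mathrm{des}(T)}=(-t)^{\sum_{i=2}^{m}(\check N(i)+\hat N(i))}(1-t)^{\sum_{i=2}^{m}p(i)}; \] otherwise the left-hand side equals $0$.
   Context: Young diagram of $\mu$: cells $(i,j)$, row $i$ from top, column $j$ from left; $\mu'_j$ is the length of column $j$; $r(u)=(i,j+1)$ for $u=(i,j)$ if it is a cell. Two cells attack if they lie in the same column, or are $(i,j)$ and $(k,j+1)$ with $i>k$. $F(\mu,n)$ is the set of fillings $T$ of $\mu$ with entries in $[n]$ such that attacking cells have distinct entries and $T(u)\le T(r(u))$ whenever $r(u)$ exists. $\mathrm{inv}(T)$ is the number of pairs of cells $(u,v)$ with $u=(j,k)$, $v=(i,k+1)$, $i<j$, such that $T(u)<T(v)<T(w)$ where $w=(j,k+1)$ if this cell exists, and $T(u)<T(v)$ otherwise; $\mathrm{des}(T)$ is the number of cells $u$ with $r(u)$ existing and $T(u)<T(r(u))$. $T[1]$ is the first column of $T$ (read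 top to bottom) and, for a sequence $C$, $\ell(C)$ is the number of pairs $i<j$ with $C(i)>C(j)$. $\mathrm{sort}^{-1}(\sigma)$ is the set of $T\in F(\mu,n)$ such that sorting every column of $T$ increasingly from top to bottom yields $\sigma$. Hat construction: given a column $C'=(C'(1),\ldots,C'(c'))$ of distinct integers and a set $S$ of size $c\in\{c',c'+1\}$, the column $\widehat C$ of length $c$ is built by placing every $x\in S\cap C'$ in the row where $x$ occurs in $C'$; if $c=c'+1$, placing the largest element of $S\setminus C'$ in row $c$; and placing the remaining elements of $S\setminus C'$, in decreasing order, in the rows occupied in $C'$ by the elements of $C'\setminus S$, in decreasing order. Root filling: $\widehat C_m$ is the last column of $\sigma$ (a single cell, since $\mu$ has distinct parts); for $i=m-1,\ldots,1$, $\widehat C_i$ is the hat construction applied to $S=$ the set of entries of column $i$ of $\sigma$ and $C'=\widehat C_{i+1}$ (column lengths of $\mu$ decrease by at most one, so the size condition holds). For a pair $(\widehat C,C')=(\widehat C_{i-1},\widehat C_i)$ with $c=|\widehat C|$, $c'=|C'|$: row $r$ is a pivot row if either $r\le c'$ and $\widehat C(r)<C'(r)$, or $r=c'+1\le c$; with pivot rows $q_1,\ldots,q_p$ put $b_j=\widehat C(q_j)$, $d_j=C'(q_j)$ if $q_j\le c'$ and $d_j=\infty$ otherwise. The pair satisfies the Non-overlapping Condition if $p\le1$ or the intervals $[b_j,d_j]$ ($[b_j,\infty)$ when $d_j=\infty$) are pairwise disjoint. Define $\check N(i)=\sum_{j=1}^p\#\{r>q_j:\ C'(r)\text{ is an entry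 of }\widehat C,\ b_j<C'(r)<d_j\}$, $\hat N(i)=\sum_{j=1}^p\#\{r<q_j:\ C'(r)\text{ is an entry of }\widehat C,\ b_j<C'(r)<d_j\}$, and $p(i)$ = number of rows $r\le c'$ with $\widehat C(r)<C'(r)$. $t$ is an indeterminate. *)

theory Defs
  imports Main "HOL-Computational_Algebra.Polynomial"
begin

text \<open>Cells are pairs (row, column), both 1-based. A shape is given by its row
lengths mu :: nat => nat (mu i = length of row i, 1-based, 0 for empty rows).
Fillings are functions on nat x nat; fillings in F(mu,n) are required to be 0
outside the diagram so that they are determined by their values on cells.\<close>

type_synonym filling = "nat \<times> nat \<Rightarrow> nat"

definition mu_of :: "nat \<Rightarrow> (nat \<Rightarrow> nat) \<Rightarrow> nat \<Rightarrow> nat" where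
  "mu_of n lam i = (if 1 \<le> i \<and> i \<le> n - 1 then lam i + (n - i) else 0)"

definition is_cell :: "(nat \<Rightarrow> nat) \<Rightarrow> nat \<times> nat \<Rightarrow> bool" where
  "is_cell mu u = (1 \<le> fst u \<and> 1 \<le> snd u \<and> snd u \<le> mu (fst u))"

definition col_len :: "(nat \<Rightarrow> nat) \<Rightarrow> nat \<Rightarrow> nat" where
  "col_len mu j = card {i. is_cell mu (i, j)}"

definition rcell :: "nat \<times> nat \<Rightarrow> nat \<times> nat" where
  "rcell u = (fst u, Suc (snd u))"

definition attack :: "(nat \<Rightarrow> nat) \<Rightarrow> nat \<times> nat \<Rightarrow> nat \<times> nat \<Rightarrow> bool" where
  "attack mu u v = (is_cell mu u \<and> is_cell mu v \<and>
     ((u \<noteq> v \<and> snd u = snd v) \<or>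
      (snd v = Suc (snd u) \<and> fst u > fst v) \<or>
      (snd u = Suc (snd v) \<and> fst v > fst u)))"

definition fillings :: "(nat \<Rightarrow> nat) \<Rightarrow> nat \<Rightarrow> filling set" where
  "fillings mu n = {T.
     (\<forall>u. is_cell mu u \<longrightarrow> T u \<in> {1..n}) \<and>
     (\<forall>u. \<not> is_cell mu u \<longrightarrow> T u = 0) \<and>
     (\<forall>u v. attack mu u v \<longrightarrow> T u \<noteq> T v) \<and>
     (\<forall>u. is_cell mu u \<and> is_cell mu (rcell u) \<longrightarrow> T u \<le> T (rcell u))}"

definition col :: "(nat \<Rightarrow> nat) \<Rightarrow> filling \<Rightarrow> nat \<Rightarrow> nat list" where
  "col mu T j = map (\<lambda>i. T (i, j)) [1..<Suc (col_len mu j)]"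

definition is_ssyt :: "(nat \<Rightarrow> nat) \<Rightarrow> nat \<Rightarrow> filling \<Rightarrow> bool" where
  "is_ssyt mu n \<sigma> =
     ((\<forall>u. is_cell mu u \<longrightarrow> \<sigma> u \<in> {1..n}) \<and>
      (\<forall>i j. is_cell mu (i, Suc j) \<and> is_cell mu (i, j) \<longrightarrow> \<sigma> (i, j) \<le> \<sigma> (i, Suc j)) \<and>
      (\<forall>i j. is_cell mu (Suc i, j) \<and> is_cell mu (i, j) \<longrightarrow> \<sigma> (i, j) < \<sigma> (Suc i, j)))"

definition sort_inv :: "(nat \<Rightarrow> nat) \<Rightarrow> nat \<Rightarrow> filling \<Rightarrow> filling set" where
  "sort_inv mu n \<sigma> = {T \<in> fillings mu n.
     \<forall>j. 1 \<le> j \<and> j \<le> mu 1 \<longrightarrow> sort (col mu T j) = col mu \<sigma> j}"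

definition inv_stat :: "(nat \<Rightarrow> nat) \<Rightarrow> filling \<Rightarrow> nat" where
  "inv_stat mu T = card {(i, j, k). is_cell mu (j, k) \<and> is_cell mu (i, Suc k) \<and> i < j \<and>
     (if is_cell mu (j, Suc k)
      then T (j, k) < T (i, Suc k) \<and> T (i, Suc k) < T (j, Suc k)
      else T (j, k) < T (i, Suc k))}"

definition des_stat :: "(nat \<Rightarrow> nat) \<Rightarrow> filling \<Rightarrow> nat" where
  "des_stat mu T = card {u. is_cell mu u \<and> is_cell mu (rcell u) \<and> T u < T (rcell u)}"

definition ell_first :: "(nat \<Rightarrow> nat) \<Rightarrow> filling \<Rightarrow> nat" where
  "ell_first mu T = card {(i, j). 1 \<le> i \<and> i < j \<and> j \<le> col_len mu 1 \<and> T (j, 1) < T (i, 1)}"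

definition hat_col :: "nat list \<Rightarrow> nat set \<Rightarrow> nat \<Rightarrow> nat list" where
  "hat_col C' S c =
    (let D = rev (sorted_list_of_set (S - set C'));
         rest = (if c = Suc (length C') then tl D else D)
     in map (\<lambda>r. if r < length C'
                  then (if C' ! r \<in> S then C' ! r
                        else rest ! card {y \<in> set C' - S. C' ! r < y})
                  else hd D) [0..<c])"

primrec root_aux :: "(nat \<Rightarrow> nat) \<Rightarrow> filling \<Rightarrow> nat \<Rightarrow> nat list" where
  "root_aux mu \<sigma> 0 = col mu \<sigma> (mu 1)"
| "root_aux mu \<sigma> (Suc k) =
     hat_col (root_aux mu \<sigma> k) (set (col mu \<sigma> (mu 1 - Suc k))) (col_len mu (mu 1 - Suc k))"

definition root_col :: "(nat \<Rightarrow> nat) \<Rightarrow> filling \<Rightarrow> nat \<Rightarrow> nat list" where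
  "root_col mu \<sigma> i = root_aux mu \<sigma> (mu 1 - i)"

text \<open>Pivot rows of the pair (Ch, C') = (hat-C_{i-1}, hat-C_i), 0-based.\<close>
definition is_pivot :: "nat list \<Rightarrow> nat list \<Rightarrow> nat \<Rightarrow> bool" where
  "is_pivot Ch C' r = ((r < length C' \<and> Ch ! r < C' ! r) \<or>
                       (r = length C' \<and> length C' < length Ch))"

definition pivots :: "nat list \<Rightarrow> nat list \<Rightarrow> nat set" where
  "pivots Ch C' = {r. is_pivot Ch C' r}"

definition closed_iv :: "nat list \<Rightarrow> nat list \<Rightarrow> nat \<Rightarrow> nat set" where
  "closed_iv Ch C' q = (if q < length C' then {Ch ! q .. C' ! q} else {Ch ! q ..})"

definition open_iv :: "nat list \<Rightarrow> nat list \<Rightarrow> nat \<Rightarrow> nat set" where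
  "open_iv Ch C' q = (if q < length C' then {Ch ! q <..< C' ! q} else {Ch ! q <..})"

definition non_overlapping :: "nat list \<Rightarrow> nat list \<Rightarrow> bool" where
  "non_overlapping Ch C' = (\<forall>q1 \<in> pivots Ch C'. \<forall>q2 \<in> pivots Ch C'.
      q1 \<noteq> q2 \<longrightarrow> closed_iv Ch C' q1 \<inter> closed_iv Ch C' q2 = {})"

definition N_check :: "nat list \<Rightarrow> nat list \<Rightarrow> nat" where
  "N_check Ch C' = (\<Sum>q \<in> pivots Ch C'.
     card {r. q < r \<and> r < length C' \<and> C' ! r \<in> set Ch \<and> C' ! r \<in> open_iv Ch C' q})"

definition N_hat :: "nat list \<Rightarrow> nat list \<Rightarrow> nat" where
  "N_hat Ch C' = (\<Sum>q \<in> pivots Ch C'.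
     card {r. r < q \<and> r < length C' \<and> C' ! r \<in> set Ch \<and> C' ! r \<in> open_iv Ch C' q})"

definition p_count :: "nat list \<Rightarrow> nat list \<Rightarrow> nat" where
  "p_count Ch C' = card {r. r < length C' \<and> Ch ! r < C' ! r}"

end

theory Submission
  imports Defs "HOL-Combinatorics.Multiset_Permutations"
begin

text \<open>For two adjacent columns \<open>C\<close>, \<open>C'\<close> the attacking condition and both statistics factor over the
  rows of \<open>C\<close> once \<open>C'\<close> is fixed, so the sum of the signed weights over all arrangements \<open>C\<close> of a
  set \<open>S\<close> is a determinant. Exchanging two neighbouring entries of \<open>C'\<close> amounts to column operations
  and an interchange of columns, hence the determinant is the sign of \<open>C'\<close> times a
  coefficient that depends only on \<open>S\<close> and \<open>S' = set C'\<close>. Summing from the left, the sign of the first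
  column is thus transported through the filling, and the sum is the product of these coefficients.

  To evaluate the coefficient, list the common entries of \<open>S\<close> and \<open>S'\<close> first: the matrix becomes block
  triangular and only the entries \<open>b \<in> S - S'\<close> and \<open>d \<in> S' - S\<close>, matched in decreasing order, matter.
  Either the intervals \<open>[b, d]\<close> are disjoint and the remaining block is triangular up to the order
  of its rows, or two of its columns are proportional. These intervals are exactly those of the
  pivot rows of the root filling.\<close>

section \<open>Determinants by Laplace expansion\<close>

text \<open>This is (-1) to the number of inversions (\<open>list_sign_eq_power\<close>), in a
  recursive form that matches Laplace expansion: the first entry contributes the cofactor sign of
  its row.\<close>

fun list_sign :: "nat list \<Rightarrow> 'a::comm_ring_1" where
  "list_sign [] = 1"
| "list_sign (x # xs) = (-1) ^ card {y \<in> set xs. y < x} * list_sign xs"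

text \<open>\<open>alt gs S\<close> is the determinant of the matrix \<open>g x\<close> with columns \<open>g\<close> from \<open>gs\<close> and rows
  \<open>x \<in> S\<close> in increasing order, expanded along its first column.\<close>
primrec alt :: "(nat \<Rightarrow> 'a) list \<Rightarrow> nat set \<Rightarrow> 'a::comm_ring_1" where
  "alt [] S = of_bool (S = {})"
| "alt (g # gs) S = (\<Sum>x\<in>S. (-1) ^ card {y \<in> S. y < x} * g x * alt gs (S - {x}))"

lemma card_less_remove:
  fixes x y :: nat
  assumes "finite S" "x \<in> S"
  shows "card {z \<in> S. z < y} = card {z \<in> S - {x}. z < y} + of_bool (x < y)"
proof (cases "x < y")
  case True
  then have "{z \<in> S. z < y} = insert x {z \<in> S - {x}. z < y}" using assms by auto
  then show ?thesis using True assms by simp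
next
  case False
  then have "{z \<in> S. z < y} = {z \<in> S - {x}. z < y}" by auto
  then show ?thesis using False by simp
qed

lemma list_sign_swap:
  assumes "distinct (P @ a # b # Q)"
  shows "list_sign (P @ a # b # Q) = - (list_sign (P @ b # a # Q) :: 'a::comm_ring_1)"
  using assms
proof (induction P)
  case Nil
  have e: "(-1::'a) ^ card {z \<in> insert y (set Q). z < x} =
     (-1) ^ of_bool (y < x) * (-1) ^ card {z \<in> set Q. z < x}" if "y \<notin> set Q" for x y
    using card_less_remove[of "insert y (set Q)" y x] that by (simp add: power_add)
  show ?case
    using Nil e[of b a] e[of a b] unfolding append_Nil list_sign.simps list.set
    by (cases "a < b") (simp_all only: distinct.simps list.set insert_iff, simp_all)
next
  case (Cons p P)
  have "set (P @ a # b # Q) = set (P @ b # a # Q)" by auto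
  then show ?case using Cons by (simp del: set_append)
qed

text \<open>Expand along both columns and let \<open>e x y\<close> be the sign of deleting row
  \<open>x\<close>, then row \<open>y\<close>. Deleting \<open>x\<close> moves \<open>y\<close>
  exactly if \<open>x < y\<close>, so \<open>e\<close> is antisymmetric, and exchanging the two
  summations gives the sign.\<close>

lemma alt_swap:
  assumes "finite S"
  shows "alt (g # h # gs) S = - (alt (h # g # gs) S :: 'a::comm_ring_1)"
proof -
  define e :: "nat \<Rightarrow> nat \<Rightarrow> 'a"
    where "e x y = (-1) ^ card {z \<in> S. z < x} * (-1) ^ card {z \<in> S - {x}. z < y}" for x y
  have e: "e x y = - e y x" if "x \<in> S" "y \<in> S" "x \<noteq> y" for x y
    using that card_less_remove[OF assms, of x y] card_less_remove[OF assms, of y x]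
    by (cases "x < y") (auto simp: e_def power_add)
  have expand: "alt (g # h # gs) S =
     (\<Sum>x\<in>S. \<Sum>y\<in>{y \<in> S. x \<noteq> y}. e x y * g x * h y * alt gs (S - {x,y}))" for g h
  proof -
    have "S - {x} = {y \<in> S. x \<noteq> y}" "S - {x} - {y} = S - {x,y}" for x y by auto
    then show ?thesis by (simp add: e_def sum_distrib_left mult.assoc mult.left_commute)
  qed
  have "alt (g # h # gs) S =
     (\<Sum>y\<in>S. \<Sum>x\<in>{x \<in> S. x \<noteq> y}. e x y * g x * h y * alt gs (S - {x,y}))"
    unfolding expand using assms assms by (rule sum.swap_restrict)
  also have "\<dots> = (\<Sum>y\<in>S. \<Sum>x\<in>{x \<in> S. y \<noteq> x}. - (e y x * h y * g x * alt gs (S - {y,x})))"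
  proof (intro sum.cong)
    fix y x assume "y \<in> S" "x \<in> {x \<in> S. y \<noteq> x}"
    then show "e x y * g x * h y * alt gs (S - {x,y}) = - (e y x * h y * g x * alt gs (S - {y,x}))"
      using e[of x y] by (simp add: insert_commute mult.commute mult.left_commute)
  qed auto
  also have "\<dots> = - alt (h # g # gs) S"
    by (simp only: expand sum_negf)
  finally show ?thesis .
qed

lemma alt_repeat:
  assumes "finite S"
  shows "alt (g # g # gs) S = (0 :: 'a::{idom,ring_char_0})"
proof -
  have "alt (g # g # gs) S + alt (g # g # gs) S = 0"
    using alt_swap[OF assms, of g g gs] by (metis ab_group_add_class.ab_left_minus)
  then show ?thesis by (metis mult_2 mult_eq_0_iff zero_neq_numeral)
qed

lemma alt_cong:
  assumes "list_all2 (\<lambda>g h. \<forall>x\<in>S. g x = h x) gs hs"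
  shows "alt gs S = alt hs S"
  using assms
proof (induction gs arbitrary: hs S)
  case (Cons g gs)
  then obtain h hs' where hs: "hs = h # hs'" and "\<forall>x\<in>S. g x = h x"
    and *: "list_all2 (\<lambda>g h. \<forall>x\<in>S. g x = h x) gs hs'"
    by (auto simp: list_all2_Cons1)
  moreover have "alt gs (S - {x}) = alt hs' (S - {x})" for x
    by (rule Cons.IH, rule list_all2_mono[OF *]) blast
  ultimately show ?case by simp
qed auto

lemma alt_linear:
  "alt ((\<lambda>x. g x + c * h x) # gs) S = alt (g # gs) S + c * alt (h # gs) S"
  by (simp add: algebra_simps sum.distrib sum_distrib_left)

lemma alt_proportional:
  assumes "finite S" "\<And>x. x \<in> S \<Longrightarrow> g x = c * h x"
  shows "alt (g # h # gs) S = (0 :: 'a::{idom,ring_char_0})"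
proof -
  have "alt (g # h # gs) S = alt ((\<lambda>x. 0 + c * h x) # h # gs) S"
    using assms by (intro alt_cong) (auto intro: list_all2_refl)
  also have "\<dots> = 0"
    by (simp only: alt_linear alt_repeat[OF assms(1)]) simp
  finally show ?thesis .
qed

text \<open>Each term of the full expansion either picks row \<open>x\<close>, which gives a factor
  0, or runs out of columns with \<open>x\<close> left over, and \<open>alt []\<close> vanishes on
  nonempty sets.\<close>

lemma alt_zero_row:
  assumes "finite S" "x \<in> S" "\<And>g. g \<in> set gs \<Longrightarrow> g x = 0"
  shows "alt gs S = 0"
  using assms
proof (induction gs arbitrary: S)
  case (Cons g gs)
  have "g y * alt gs (S - {y}) = 0" if "y \<in> S" for y
  proof (cases "y = x")
    case True
    then show ?thesis using Cons.prems(3)[of g] by simp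
  next
    case False
    then have "alt gs (S - {y}) = 0"
      using Cons.prems by (intro Cons.IH) simp_all
    then show ?thesis by simp
  qed
  then show ?case by (simp add: mult.assoc)
qed auto

lemma alt_unit_row:
  assumes "finite S" "x \<in> S" "\<And>g. g \<in> set gs \<Longrightarrow> g x = 0"
  shows "alt (g # gs) S = (-1) ^ card {y \<in> S. y < x} * g x * alt gs (S - {x})"
proof -
  have "alt gs (S - {y}) = 0" if "y \<in> S - {x}" for y
    using that assms(1,2) by (intro alt_zero_row[of _ x] assms(3)) simp_all
  then show ?thesis
    using assms(1,2) by (simp add: sum.remove[of S x])
qed

text \<open>Leibniz formula: the permutations are grouped by their first entry, which is the row
  chosen in the first column.\<close>

lemma alt_eq_sum_permutations:
  assumes "finite S" "card S = length gs"
  shows "alt gs S = (\<Sum>C\<in>permutations_of_set S. list_sign C * prod_list (map2 (\<lambda>g x. g x) gs C))"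
  using assms
proof (induction gs arbitrary: S)
  case (Cons g gs)
  have "S \<noteq> {}" using Cons.prems by auto
  have "(\<Sum>C\<in>permutations_of_set S. list_sign C * prod_list (map2 (\<lambda>g x. g x) (g # gs) C)) =
    (\<Sum>x\<in>S. \<Sum>C\<in>(#) x ` permutations_of_set (S - {x}).
        list_sign C * prod_list (map2 (\<lambda>g x. g x) (g # gs) C))"
    unfolding permutations_of_set_nonempty[OF \<open>S \<noteq> {}\<close>]
    using Cons.prems by (intro sum.UNION_disjoint) auto
  also have "\<dots> = (\<Sum>x\<in>S. \<Sum>C\<in>permutations_of_set (S - {x}).
      (-1) ^ card {y \<in> S. y < x} * g x * (list_sign C * prod_list (map2 (\<lambda>g x. g x) gs C)))"
  proof (rule sum.cong[OF refl])
    fix x assume "x \<in> S"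
    have "{y \<in> set C. y < x} = {y \<in> S. y < x}" if "C \<in> permutations_of_set (S - {x})" for C
      using that by (auto simp: permutations_of_set_def)
    then show "(\<Sum>C\<in>(#) x ` permutations_of_set (S - {x}).
        list_sign C * prod_list (map2 (\<lambda>g x. g x) (g # gs) C)) =
      (\<Sum>C\<in>permutations_of_set (S - {x}).
      (-1) ^ card {y \<in> S. y < x} * g x * (list_sign C * prod_list (map2 (\<lambda>g x. g x) gs C)))"
      by (auto simp: sum.reindex mult.assoc mult.left_commute intro!: sum.cong)
  qed
  also have "\<dots> = alt (g # gs) S"
    using Cons.prems by (auto simp: sum_distrib_left[symmetric] Cons.IH intro!: sum.cong)
  finally show ?case by simp
qed auto

section \<open>The matrix of a column\<close>

text \<open>The contribution of a row with entry \<open>x\<close> and right neighbour \<open>a\<close>, where \<open>X\<close> are the entries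
  above \<open>a\<close> in its column.\<close>
definition entry_wt :: "'a::comm_ring_1 \<Rightarrow> nat set \<Rightarrow> nat \<Rightarrow> nat \<Rightarrow> 'a" where
  "entry_wt t X a x = (if x \<le> a \<and> x \<notin> X
     then t ^ card {y \<in> X. x < y \<and> y < a} * (if x < a then 1 - t else 1) else 0)"

text \<open>The matrix has a column for each entry of the right column \<open>C'\<close> and a row
  for each possible left neighbour \<open>x\<close>. The accumulator \<open>X\<close> holds the
  entries of \<open>C'\<close> already passed.\<close>

fun row_wts :: "'a::comm_ring_1 \<Rightarrow> nat set \<Rightarrow> nat list \<Rightarrow> (nat \<Rightarrow> 'a) list" where
  "row_wts t X [] = []"
| "row_wts t X (a # as) = entry_wt t X a # row_wts t (insert a X) as"

text \<open>This compares the matrix column of \<open>b\<close> with \<open>a\<close> below it and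
  with \<open>a\<close> above it. For \<open>x < a\<close> outside \<open>X\<close> it is the
  identity 1 = t + (1 - t), since \<open>a\<close> raises the exponent by one; for
  \<open>x = a\<close> the first summand vanishes; for \<open>x > a\<close> the entry
  \<open>a\<close> is invisible.\<close>

lemma entry_wt_exchange:
  assumes "finite X" "a \<notin> X" "a < b"
  shows "entry_wt t X b x = entry_wt t (insert a X) b x +
           t ^ card {y \<in> X. a < y \<and> y < b} * (1 - t) * entry_wt t X a x"
proof (cases "x < a \<and> x \<notin> X")
  case True
  have 1: "card {y \<in> X. x < y \<and> y < b} =
      card {y \<in> X. x < y \<and> y < a} + card {y \<in> X. a < y \<and> y < b}"
  proof -
    have "{y \<in> X. x < y \<and> y < b} = {y \<in> X. x < y \<and> y < a} \<union> {y \<in> X. a < y \<and> y < b}"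
      using True assms by (auto simp: not_less le_less)
    then show ?thesis using assms by (simp add: card_Un_disjoint disjoint_iff)
  qed
  have "{y \<in> insert a X. x < y \<and> y < b} = insert a {y \<in> X. x < y \<and> y < b}"
    using True assms by auto
  then have 2: "card {y \<in> insert a X. x < y \<and> y < b} = Suc (card {y \<in> X. x < y \<and> y < b})"
    using assms by simp
  show ?thesis
    using True assms unfolding entry_wt_def 2 unfolding 1 by (simp add: power_add algebra_simps)
next
  case False
  then consider "x \<in> X" | "x = a" | "x \<notin> X" "a < x" by fastforce
  then show ?thesis
  proof cases
    case 3
    then have "{y \<in> insert a X. x < y \<and> y < b} = {y \<in> X. x < y \<and> y < b}" by auto
    with 3 show ?thesis by (simp add: entry_wt_def)
  next
    case 2
    have e: "{y \<in> X. a < y \<and> y < a} = {}" by auto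
    show ?thesis using assms 2 by (simp add: entry_wt_def e)
  qed (simp add: entry_wt_def)
qed

lemma entry_wt_insert_large: "a \<le> b \<Longrightarrow> x \<noteq> b \<Longrightarrow> entry_wt t (insert b X) a x = entry_wt t X a x"
proof -
  assume "a \<le> b" "x \<noteq> b"
  then have "{y \<in> insert b X. x < y \<and> y < a} = {y \<in> X. x < y \<and> y < a}" by auto
  then show ?thesis using \<open>x \<noteq> b\<close> by (simp add: entry_wt_def)
qed

text \<open>With \<open>b\<close> first, its column is that of the other order plus a multiple of
  the column of \<open>a\<close>. Removing this multiple and interchanging the two columns gives the
  matrix with \<open>a\<close> first.\<close>

lemma alt_row_wts_swap_less:
  fixes t :: "'a::{idom,ring_char_0}"
  assumes "finite S" "finite X" "a \<notin> X" "a < b"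
  shows "alt (row_wts t X (a # b # Q)) S = - alt (row_wts t X (b # a # Q)) S"
proof -
  let ?c = "t ^ card {y \<in> X. a < y \<and> y < b} * (1 - t)"
  let ?f = "entry_wt t X a" and ?h = "entry_wt t (insert a X) b"
  let ?gs = "row_wts t (insert a (insert b X)) Q"
  have 1: "entry_wt t (insert b X) a = ?f"
  proof
    fix x show "entry_wt t (insert b X) a x = ?f x"
      using assms entry_wt_insert_large[of a b x t X] by (cases "x = b") (auto simp: entry_wt_def)
  qed
  have 2: "entry_wt t X b = (\<lambda>x. ?h x + ?c * ?f x)"
    using entry_wt_exchange[OF assms(2-4)] by auto
  have "alt (row_wts t X (b # a # Q)) S = alt (?h # ?f # ?gs) S + ?c * alt (?f # ?f # ?gs) S"
    by (simp only: row_wts.simps 1 2 alt_linear)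
  also have "\<dots> = - alt (?f # ?h # ?gs) S"
    using alt_swap[OF assms(1), of ?h ?f ?gs] by (simp only: alt_repeat[OF assms(1)] mult_zero_right add_0_right)
  finally show ?thesis by (simp only: row_wts.simps insert_commute minus_minus)
qed

lemma alt_row_wts_swap:
  fixes t :: "'a::{idom,ring_char_0}"
  assumes "finite S" "finite X" "distinct (P @ a # b # Q)" "set (P @ a # b # Q) \<inter> X = {}"
  shows "alt (row_wts t X (P @ a # b # Q)) S = - alt (row_wts t X (P @ b # a # Q)) S"
  using assms
proof (induction P arbitrary: X S)
  case Nil
  then show ?case
    using alt_row_wts_swap_less[of S X a b t Q] alt_row_wts_swap_less[of S X b a t Q]
    by (cases "a < b") (auto simp del: alt.simps)
next
  case (Cons p P)
  have "alt (row_wts t (insert p X) (P @ a # b # Q)) (S - {x}) =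
     - alt (row_wts t (insert p X) (P @ b # a # Q)) (S - {x})" for x
    by (rule Cons.IH) (use Cons.prems in auto)
  then show ?case by (simp add: sum_negf del: alt.simps(1))
qed

section \<open>Permutations as chains of adjacent transpositions\<close>

inductive adjacent_swaps :: "'b list \<Rightarrow> 'b list \<Rightarrow> bool" where
  no_swap: "adjacent_swaps xs xs"
| one_swap: "adjacent_swaps xs (P @ a # b # Q) \<Longrightarrow> adjacent_swaps xs (P @ b # a # Q)"

lemma adjacent_swaps_trans: "adjacent_swaps ys zs \<Longrightarrow> adjacent_swaps xs ys \<Longrightarrow> adjacent_swaps xs zs"
  by (induction rule: adjacent_swaps.induct) (auto intro: adjacent_swaps.intros)

lemma adjacent_swaps_Cons: "adjacent_swaps xs ys \<Longrightarrow> adjacent_swaps (x # xs) (x # ys)"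
proof (induction rule: adjacent_swaps.induct)
  case (one_swap xs P a b Q)
  then show ?case using adjacent_swaps.one_swap[of "x # xs" "x # P" a b Q] by simp
qed (auto intro: adjacent_swaps.intros)

lemma adjacent_swaps_move: "adjacent_swaps (x # us @ vs) (us @ x # vs)"
proof (induction us)
  case (Cons u us)
  have "adjacent_swaps (x # u # us @ vs) ([] @ u # x # us @ vs)"
    by (rule adjacent_swaps.one_swap) (simp add: adjacent_swaps.no_swap)
  with adjacent_swaps_trans[OF adjacent_swaps_Cons[OF Cons, of u]] show ?case by simp
qed (simp add: adjacent_swaps.no_swap)

lemma mset_eq_imp_adjacent_swaps: "mset xs = mset ys \<Longrightarrow> adjacent_swaps xs ys"
proof (induction xs arbitrary: ys)
  case (Cons x xs)
  then have "x \<in> set ys" by (metis list.set_intros(1) set_mset_mset)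
  then obtain us vs where ys: "ys = us @ x # vs" by (auto simp: in_set_conv_decomp)
  then have "mset xs = mset (us @ vs)" using Cons by simp
  then have "adjacent_swaps (x # xs) (x # us @ vs)" by (intro adjacent_swaps_Cons Cons.IH)
  then show ?case unfolding ys by (rule adjacent_swaps_trans[OF adjacent_swaps_move])
qed (simp add: adjacent_swaps.no_swap)

text \<open>An adjacent swap negates both factors, so their product is constant along a chain of
  swaps.\<close>

lemma list_sign_alt_permute:
  fixes t :: "'a::{idom,ring_char_0}"
  assumes "finite S" "distinct xs" "distinct ys" "set xs = set ys"
  shows "list_sign xs * alt (row_wts t {} xs) S = list_sign ys * alt (row_wts t {} ys) S"
proof -
  have "adjacent_swaps xs ys"
    using assms by (intro mset_eq_imp_adjacent_swaps) (simp add: set_eq_iff_mset_eq_distinct)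
  then show ?thesis using \<open>distinct xs\<close>
  proof (induction rule: adjacent_swaps.induct)
    case (one_swap xs P a b Q)
    have "mset xs = mset zs" if "adjacent_swaps xs zs" for zs :: "nat list"
      using that by (induction rule: adjacent_swaps.induct) auto
    with one_swap have d: "distinct (P @ a # b # Q)" by (metis mset_eq_imp_distinct_iff)
    show ?case
      using one_swap list_sign_swap[OF d, where ?'a = 'a] alt_row_wts_swap[OF assms(1) _ d, of "{}" t]
      by simp
  qed auto
qed

lemma list_sign_square: "list_sign xs * list_sign xs = (1 :: 'a::comm_ring_1)"
proof (induction xs)
  case (Cons x xs)
  have "list_sign (x # xs) * list_sign (x # xs) =
    ((-1) ^ card {y \<in> set xs. y < x} * (-1) ^ card {y \<in> set xs. y < x}) *
    (list_sign xs * list_sign xs :: 'a)"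
    by (simp add: ac_simps)
  then show ?case using Cons by (simp flip: power_mult_distrib)
qed auto

lemma distinct_if_decreasing: "sorted_wrt (>) xs \<Longrightarrow> distinct xs" for xs :: "'a::order list"
  by (induction xs) auto

lemma list_sign_decreasing:
  assumes "length xs = length ys" "sorted_wrt (>) xs" "sorted_wrt (>) ys"
  shows "list_sign xs = list_sign ys"
  using assms
proof (induction xs ys rule: list_induct2)
  case (Cons x xs y ys)
  have "card {z \<in> set zs. z < a} = length zs" if "sorted_wrt (>) (a # zs)" for a :: nat and zs
  proof -
    have "{z \<in> set zs. z < a} = set zs" using that by auto
    moreover have "distinct zs" using that by (simp add: distinct_if_decreasing)
    ultimately show ?thesis by (simp add: distinct_card)
  qed
  then show ?case using Cons by simp
qed auto

section \<open>Evaluation of the determinant\<close>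

text \<open>For decreasing lists with \<open>b < d\<close> in each pair this says that the intervals
  \<open>[b, d]\<close> are pairwise disjoint (\<open>interlaced_iff_disjoint\<close>).\<close>

fun interlaced :: "nat list \<Rightarrow> nat list \<Rightarrow> bool" where
  "interlaced (b # Bs) (d # Ds) \<longleftrightarrow> (\<forall>d' \<in> set Ds. d' < b) \<and> interlaced Bs Ds"
| "interlaced _ _ \<longleftrightarrow> True"

definition gap_count :: "nat set \<Rightarrow> nat list \<Rightarrow> nat list \<Rightarrow> nat" where
  "gap_count A Bs Ds = (\<Sum>(b, d)\<leftarrow>zip Bs Ds. card {a \<in> A. b < a \<and> a < d})"

lemma gap_count_Nil [simp]: "gap_count A [] Ds = 0"
  and gap_count_Cons [simp]: "gap_count A (b # Bs) (d # Ds) =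
    card {a \<in> A. b < a \<and> a < d} + gap_count A Bs Ds"
  by (simp_all add: gap_count_def)

lemma gap_count_insert:
  assumes "finite A" "a \<notin> A"
  shows "gap_count (insert a A) Bs Ds = gap_count {a} Bs Ds + gap_count A Bs Ds"
proof -
  have "card {x \<in> insert a A. b < x \<and> x < d} =
     card {x \<in> {a}. b < x \<and> x < d} + card {x \<in> A. b < x \<and> x < d}" for b d
  proof -
    have "{x \<in> insert a A. b < x \<and> x < d} = {x \<in> {a}. b < x \<and> x < d} \<union> {x \<in> A. b < x \<and> x < d}"
      by auto
    then show ?thesis using assms by (subst card_Un_disjoint[symmetric]) auto
  qed
  then show ?thesis by (simp add: gap_count_def sum_list_addf[symmetric] case_prod_unfold)
qed

lemma gap_count_insert_large:
  assumes "\<forall>d' \<in> set Ds. d' \<le> d"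
  shows "gap_count (insert d A) Bs Ds = gap_count A Bs Ds"
proof -
  have "{a \<in> insert d A. b < a \<and> a < d'} = {a \<in> A. b < a \<and> a < d'}" if "d' \<in> set Ds" for b d'
    using that assms by fastforce
  then show ?thesis
    unfolding gap_count_def by (intro arg_cong[where f = sum_list] map_cong) (auto dest: set_zip_rightD)
qed

text \<open>Both sides count, modulo 2, the pairs of an element of \<open>As\<close> and an interval \<open>(b, d)\<close> around it:
  an element above or below the whole interval is inverted equally often with \<open>b\<close> and with \<open>d\<close>.\<close>
lemma list_sign_append_pairs:
  assumes "list_all2 (<) Bs Ds" "sorted_wrt (>) Bs" "sorted_wrt (>) Ds"
    and "distinct As" "set As \<inter> set Bs = {}" "set As \<inter> set Ds = {}"
  shows "list_sign (As @ Ds) * list_sign (As @ Bs) = ((-1) ^ gap_count (set As) Bs Ds :: 'a::comm_ring_1)"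
  using assms(4-6)
proof (induction As)
  case Nil
  have "gap_count {} Bs Ds = 0" by (simp add: gap_count_def)
  moreover have "list_sign Ds = (list_sign Bs :: 'a)"
    using assms by (intro list_sign_decreasing) (auto dest: list_all2_lengthD)
  ultimately show ?case by (simp add: list_sign_square)
next
  case (Cons a As)
  have pair: "(-1 :: 'a) ^ (card {y \<in> set Ds. y < a} + card {y \<in> set Bs. y < a}) = (-1) ^ gap_count {a} Bs Ds"
    if "a \<notin> set Ds" using assms(1-3) that
  proof (induction Bs Ds rule: list_all2_induct)
    case (Cons b Bs d Ds)
    have ins: "card {y \<in> set (z # zs). y < a} = of_bool (z < a) + card {y \<in> set zs. y < a}"
      if "sorted_wrt (>) (z # zs)" for z zs
    proof -
      have "set (z # zs) - {z} = set zs" using that by auto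
      then show ?thesis using card_less_remove[of "set (z # zs)" z a] by simp
    qed
    have "(-1 :: 'a) ^ (of_bool (d < a) + of_bool (b < a)) = (-1) ^ card {x \<in> {a}. b < x \<and> x < d}"
    proof -
      have "{x \<in> {a}. b < x \<and> x < d} = (if b < a \<and> a < d then {a} else {})" by auto
      then show ?thesis using Cons by (simp del: Collect_conv_if2 Collect_conv_if)
    qed
    moreover have "(-1 :: 'a) ^ (card {y \<in> set Ds. y < a} + card {y \<in> set Bs. y < a}) = (-1) ^ gap_count {a} Bs Ds"
      using Cons by simp
    moreover have "card {y \<in> set (d # Ds). y < a} + card {y \<in> set (b # Bs). y < a} =
      (of_bool (d < a) + of_bool (b < a)) + (card {y \<in> set Ds. y < a} + card {y \<in> set Bs. y < a})"
      using Cons.prems by (simp only: ins)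
    ultimately show ?case by (simp only: power_add gap_count_Cons)
  qed auto
  have split: "card {y \<in> set (As @ Zs). y < a} = card {y \<in> set As. y < a} + card {y \<in> set Zs. y < a}"
    if "set As \<inter> set Zs = {}" for Zs
  proof -
    have "{y \<in> set (As @ Zs). y < a} = {y \<in> set As. y < a} \<union> {y \<in> set Zs. y < a}" by auto
    then show ?thesis using that by (subst card_Un_disjoint[symmetric]) auto
  qed
  have d: "set As \<inter> set Bs = {}" "set As \<inter> set Ds = {}" "a \<notin> set Ds" "distinct As"
    using Cons.prems by auto
  have "list_sign ((a # As) @ Ds) * list_sign ((a # As) @ Bs) =
    ((-1) ^ card {y \<in> set As. y < a} * (-1) ^ card {y \<in> set As. y < a}) *
    (-1) ^ (card {y \<in> set Ds. y < a} + card {y \<in> set Bs. y < a}) *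
    (list_sign (As @ Ds) * list_sign (As @ Bs) :: 'a)"
    unfolding append_Cons list_sign.simps split[OF d(1)] split[OF d(2)] power_add by (simp only: ac_simps)
  also have "\<dots> = (-1) ^ gap_count (set (a # As)) Bs Ds"
  proof -
    have "gap_count (set (a # As)) Bs Ds = gap_count {a} Bs Ds + gap_count (set As) Bs Ds"
      using Cons.prems by (simp add: gap_count_insert[of "set As"])
    then show ?thesis
      unfolding pair[OF d(3)] Cons.IH[OF d(4,1,2)] power_mult_distrib[symmetric]
      by (simp add: power_add)
  qed
  finally show ?case .
qed

text \<open>Once \<open>a\<close> has been passed it counts as an entry above, so row
  \<open>a\<close> vanishes in all later columns, while its entry in its own column is 1. The rows
  of \<open>As\<close> are thus stripped one by one; the factor \<open>list_sign Bs\<close> cancels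
  the part of \<open>list_sign (As @ Bs)\<close> that is not due to them.\<close>

lemma alt_common_prefix:
  assumes "distinct (As @ Bs)" "set As \<inter> X = {}"
  shows "alt (row_wts t X (As @ Ds)) (set (As @ Bs)) =
    list_sign (As @ Bs) * list_sign Bs * alt (row_wts t (X \<union> set As) Ds) (set Bs)"
  using assms
proof (induction As arbitrary: X)
  case Nil
  then show ?case by (simp add: list_sign_square)
next
  case (Cons a As)
  have zero: "g a = 0" if "g \<in> set (row_wts t Y zs)" "a \<in> Y" for g Y zs
    using that by (induction zs arbitrary: Y) (auto simp: entry_wt_def)
  have "alt (row_wts t X ((a # As) @ Ds)) (set ((a # As) @ Bs)) =
     (-1) ^ card {y \<in> set ((a # As) @ Bs). y < a} * entry_wt t X a a *
     alt (row_wts t (insert a X) (As @ Ds)) (set ((a # As) @ Bs) - {a})"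
    unfolding append_Cons row_wts.simps by (intro alt_unit_row) (auto intro: zero)
  also have "entry_wt t X a a = 1"
  proof -
    have e: "{y \<in> X. a < y \<and> y < a} = {}" by auto
    show ?thesis using Cons.prems by (simp add: entry_wt_def e)
  qed
  also have "set ((a # As) @ Bs) - {a} = set (As @ Bs)" using Cons.prems by auto
  also have "{y \<in> set ((a # As) @ Bs). y < a} = {y \<in> set (As @ Bs). y < a}" by auto
  also have "alt (row_wts t (insert a X) (As @ Ds)) (set (As @ Bs)) =
     list_sign (As @ Bs) * list_sign Bs * alt (row_wts t (insert a X \<union> set As) Ds) (set Bs)"
    using Cons.prems by (intro Cons.IH) auto
  finally show ?case by (simp add: mult.assoc)
qed

text \<open>Look at the largest left end \<open>b\<close>. If all later right ends lie below
  \<open>b\<close>, row \<open>b\<close> is zero outside the first column. Otherwise every row lies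
  below the first two right ends, and these two columns are proportional.\<close>

lemma alt_decreasing:
  fixes t :: "'a::{idom,ring_char_0}"
  assumes "list_all2 (<) Bs Ds" "sorted_wrt (>) Bs" "sorted_wrt (>) Ds"
    and "set Bs \<inter> set Ds = {}" "set Bs \<inter> X = {}" "finite X"
  shows "alt (row_wts t X Ds) (set Bs) =
    (if interlaced Bs Ds then list_sign Bs * t ^ gap_count X Bs Ds * (1 - t) ^ length Bs else 0)"
  using assms
proof (induction Bs Ds arbitrary: X rule: list_all2_induct)
  case (Cons b Bs d Ds)
  show ?case
  proof (cases "\<forall>d' \<in> set Ds. d' < b")
    case True
    have zero: "g b = 0" if "g \<in> set (row_wts t Y zs)" "\<forall>z\<in>set zs. z < b" for g Y zs
      using that by (induction zs arbitrary: Y) (auto simp: entry_wt_def)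
    have "alt (row_wts t X (d # Ds)) (set (b # Bs)) =
       (-1) ^ card {y \<in> set (b # Bs). y < b} * entry_wt t X d b *
       alt (row_wts t (insert d X) Ds) (set (b # Bs) - {b})"
      unfolding row_wts.simps using True by (intro alt_unit_row) (auto intro: zero)
    also have "set (b # Bs) - {b} = set Bs" using Cons.prems by auto
    also have "{y \<in> set (b # Bs). y < b} = {y \<in> set Bs. y < b}" by auto
    also have "entry_wt t X d b = t ^ card {a \<in> X. b < a \<and> a < d} * (1 - t)"
      using Cons.hyps Cons.prems by (simp add: entry_wt_def)
    also have "alt (row_wts t (insert d X) Ds) (set Bs) =
      (if interlaced Bs Ds then list_sign Bs * t ^ gap_count (insert d X) Bs Ds * (1 - t) ^ length Bs else 0)"
      using Cons.prems by (intro Cons.IH) auto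
    also have "gap_count (insert d X) Bs Ds = gap_count X Bs Ds"
      using Cons.prems by (intro gap_count_insert_large) auto
    finally show ?thesis using True by (simp add: power_add)
  next
    case False
    then obtain d' Ds' where Ds: "Ds = d' # Ds'" and d': "b \<le> d'"
      using Cons.prems by (cases Ds) fastforce+
    have "alt (row_wts t X (d # Ds)) (set (b # Bs)) = 0"
      unfolding Ds row_wts.simps
    \<comment> \<open>The two columns differ only by the elements of \<open>X\<close> between
      \<open>d'\<close> and \<open>d\<close>. The bound \<open>d' \<le> y\<close> is closed because
      \<open>d'\<close> itself may belong to \<open>X\<close>.\<close>
    proof (rule alt_proportional[where c = "t ^ card {y \<in> X. d' \<le> y \<and> y < d}"])
      fix x assume x: "x \<in> set (b # Bs)"
      have d: "x < d'" "d' < d" "x \<notin> X" "x \<noteq> d"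
        using x d' Ds Cons.prems by (auto simp: order.strict_iff_order)
      have "{y \<in> X. x < y \<and> y < d} = {y \<in> X. d' \<le> y \<and> y < d} \<union> {y \<in> X. x < y \<and> y < d'}"
        using d by auto
      then have "card {y \<in> X. x < y \<and> y < d} =
          card {y \<in> X. d' \<le> y \<and> y < d} + card {y \<in> X. x < y \<and> y < d'}"
        using Cons.prems by (subst card_Un_disjoint[symmetric]) auto
      then show "entry_wt t X d x = t ^ card {y \<in> X. d' \<le> y \<and> y < d} * entry_wt t (insert d X) d' x"
        using d entry_wt_insert_large[of d' d x t X]
        by (simp only: order.strict_implies_order not_False_eq_True) (simp add: entry_wt_def power_add)
    qed simp
    then show ?thesis using False by (simp only: interlaced.simps if_False simp_thms)
  qed
qed auto

definition decreasing_list :: "nat set \<Rightarrow> nat list" where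
  "decreasing_list A = rev (sorted_list_of_set A)"

lemma decreasing_list [simp]:
  "finite A \<Longrightarrow> set (decreasing_list A) = A" "sorted_wrt (>) (decreasing_list A)"
  "length (decreasing_list A) = card A" "distinct (decreasing_list A)"
  by (simp_all add: decreasing_list_def sorted_wrt_rev)

text \<open>Reorder \<open>xs\<close> so that the common entries come first and the others follow in
  decreasing order. The signs of \<open>As @ Ds\<close> and \<open>As @ Bs\<close> combine to a
  power of -1 with exponent \<open>gap_count\<close>, which turns \<open>t\<close> into
  \<open>- t\<close>.\<close>

lemma alt_row_wts_eval:
  fixes t :: "'a::{idom,ring_char_0}" and S :: "nat set" and xs :: "nat list"
  defines "Bs \<equiv> decreasing_list (S - set xs)" and "Ds \<equiv> decreasing_list (set xs - S)"
  assumes "finite S" "distinct xs" "list_all2 (<) Bs Ds"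
  shows "alt (row_wts t {} xs) S = list_sign xs *
    (if interlaced Bs Ds then (- t) ^ gap_count (S \<inter> set xs) Bs Ds * (1 - t) ^ length Bs else 0)"
proof -
  define As where "As = sorted_list_of_set (S \<inter> set xs)"
  have As: "set As = S \<inter> set xs" "distinct As" and Bs: "set Bs = S - set xs" "distinct Bs" "sorted_wrt (>) Bs"
    and Ds: "set Ds = set xs - S" "distinct Ds" "sorted_wrt (>) Ds"
    using assms by (auto simp: As_def)
  have S: "S = set (As @ Bs)" using As Bs by auto
  have "list_sign xs * alt (row_wts t {} xs) S = list_sign (As @ Ds) * alt (row_wts t {} (As @ Ds)) S"
    using assms As Ds by (intro list_sign_alt_permute) auto
  also have "alt (row_wts t {} (As @ Ds)) S =
      list_sign (As @ Bs) * list_sign Bs * alt (row_wts t (set As) Ds) (set Bs)"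
    unfolding S using As Bs alt_common_prefix[of As Bs "{}" t Ds] by auto
  also have "alt (row_wts t (set As) Ds) (set Bs) =
     (if interlaced Bs Ds then list_sign Bs * t ^ gap_count (set As) Bs Ds * (1 - t) ^ length Bs else 0)"
    using assms As Bs Ds by (intro alt_decreasing) auto
  also have "list_sign (As @ Ds) * (list_sign (As @ Bs) * list_sign Bs * \<dots>) =
    (list_sign (As @ Ds) * list_sign (As @ Bs)) * (list_sign Bs * list_sign Bs) *
    (if interlaced Bs Ds then t ^ gap_count (set As) Bs Ds * (1 - t) ^ length Bs else 0)"
    by simp
  also have "\<dots> = (if interlaced Bs Ds
     then (- t) ^ gap_count (set As) Bs Ds * (1 - t) ^ length Bs else 0)" (is "_ = ?K")
  proof -
    have "list_sign (As @ Ds) * list_sign (As @ Bs) = ((-1) ^ gap_count (set As) Bs Ds :: 'a)"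
      using assms As Bs Ds by (intro list_sign_append_pairs) auto
    then show ?thesis
      by (simp add: list_sign_square power_minus[of t] mult.assoc)
  qed
  finally have "list_sign xs * (list_sign xs * alt (row_wts t {} xs) S) = list_sign xs * ?K"
    by simp
  then show ?thesis
    by (simp add: mult.assoc[symmetric] list_sign_square As)
qed

section \<open>Transfer between adjacent columns\<close>

text \<open>A row of \<open>C\<close> past the end of \<open>C'\<close> attacks every cell of
  \<open>C'\<close>, and its inversions follow the second clause of \<open>inv_stat\<close>; hence
  the separate factor.\<close>

definition pair_wt :: "'a::comm_ring_1 \<Rightarrow> nat list \<Rightarrow> nat list \<Rightarrow> 'a" where
  "pair_wt t C C' = (\<Prod>i<length C.
     if i < length C' then entry_wt t (set (take i C')) (C' ! i) (C ! i)
     else if C ! i \<in> set C' then 0 else t ^ card {y \<in> set C'. C ! i < y})"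

lemma length_row_wts [simp]: "length (row_wts t X xs) = length xs"
  by (induction xs arbitrary: X) auto

lemma row_wts_nth: "i < length xs \<Longrightarrow> row_wts t X xs ! i = entry_wt t (X \<union> set (take i xs)) (xs ! i)"
  by (induction xs arbitrary: X i) (auto simp: nth_Cons' take_Cons' Un_insert_left)

lemma alt_row_wts_eq_sum:
  assumes "finite S" "card S = length xs"
  shows "alt (row_wts t {} xs) S = (\<Sum>C\<in>permutations_of_set S. list_sign C *
     (\<Prod>i<length xs. entry_wt t (set (take i xs)) (xs ! i) (C ! i)))"
proof -
  have "prod_list (map2 (\<lambda>g x. g x) (row_wts t {} xs) C) =
     (\<Prod>i<length xs. entry_wt t (set (take i xs)) (xs ! i) (C ! i))"
    if "C \<in> permutations_of_set S" for C
    using that assms length_finite_permutations_of_set[OF that]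
    by (simp add: prod.list_conv_set_nth row_wts_nth atLeast0LessThan)
  then show ?thesis
    using assms by (subst alt_eq_sum_permutations) auto
qed

text \<open>A column one longer than its right neighbour is treated by adding to the latter an entry
  \<open>N\<close> that exceeds everything; it plays the role of \<open>d = \<infinity>\<close>.\<close>
definition pad :: "nat \<Rightarrow> nat \<Rightarrow> nat list \<Rightarrow> nat list" where
  "pad N c xs = (if c = length xs then xs else xs @ [N])"

text \<open>Since \<open>N\<close> exceeds every entry, the padded row always looks like a descent.
  This costs one extra factor \<open>1 - t\<close> and leaves the power of \<open>t\<close>
  unchanged.\<close>

lemma pair_wt_pad:
  assumes "length C = length C' \<or> length C = Suc (length C')" "set C \<union> set C' \<subseteq> {..<N}"
  shows "(\<Prod>i<length C. entry_wt t (set (take i (pad N (length C) C'))) (pad N (length C) C' ! i) (C ! i)) =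
    (if length C = length C' then 1 else 1 - t) * pair_wt t C C'"
proof (cases "length C = length C'")
  case True
  then show ?thesis by (simp add: pad_def pair_wt_def)
next
  case False
  then have l: "length C = Suc (length C')" using assms by simp
  let ?k = "length C'"
  have k: "C ! ?k < N" using assms(2) l by (metis UnCI lessI lessThan_iff nth_mem subsetD)
  have "{y \<in> set C'. C ! ?k < y \<and> y < N} = {y \<in> set C'. C ! ?k < y}" using assms(2) by auto
  then have "entry_wt t (set C') N (C ! ?k) =
     (1 - t) * (if C ! ?k \<in> set C' then 0 else t ^ card {y \<in> set C'. C ! ?k < y})"
    using k by (simp add: entry_wt_def)
  then show ?thesis
    using l by (simp add: pad_def pair_wt_def nth_append mult.left_commute)
qed

lemma list_sign_append_large: "(\<And>x. x \<in> set xs \<Longrightarrow> x < N) \<Longrightarrow> list_sign (xs @ [N]) = list_sign xs"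
proof (induction xs)
  case (Cons x xs)
  have "{y \<in> set (xs @ [N]). y < x} = {y \<in> set xs. y < x}" using Cons.prems[of x] by auto
  then show ?case using Cons by simp
qed auto

text \<open>The intervals come from the padded set \<open>S''\<close>, but the exponent of
  \<open>1 - t\<close> counts \<open>S' - S\<close> without \<open>N\<close>: the artificial descent
  at \<open>N\<close> is divided out.\<close>

definition transfer_coeff :: "'a::comm_ring_1 \<Rightarrow> nat \<Rightarrow> nat set \<Rightarrow> nat set \<Rightarrow> 'a" where
  "transfer_coeff t N S S' =
    (let S'' = (if card S = card S' then S' else insert N S');
         Bs = decreasing_list (S - S''); Ds = decreasing_list (S'' - S)
     in if interlaced Bs Ds then (- t) ^ gap_count (S \<inter> S'') Bs Ds * (1 - t) ^ card (S' - S) else 0)"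

lemma sum_pair_wt:
  fixes t :: "'a::{idom,ring_char_0}"
  assumes "t \<noteq> 1" "finite S" "distinct C'" "S \<union> set C' \<subseteq> {..<N}"
    and c: "card S = length C' \<or> card S = Suc (length C')"
    and dom: "list_all2 (<) (decreasing_list (S - set (pad N (card S) C')))
            (decreasing_list (set (pad N (card S) C') - S))"
  shows "(\<Sum>C\<in>permutations_of_set S. list_sign C * pair_wt t C C') =
     list_sign C' * transfer_coeff t N S (set C')"
proof -
  define xs where "xs = pad N (card S) C'"
  \<comment> \<open>The surplus factor produced by padding. It is nonzero because \<open>t\<close>
    differs from 1, and is cancelled at the end.\<close>
  define u where "u = (if card S = length C' then 1 else 1 - t)"
  have card: "card (set C') = length C'" using assms by (simp add: distinct_card)
  have N: "N \<notin> S" "N \<notin> set C'" using assms(4) by auto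
  have xs: "distinct xs" "set xs = (if card S = card (set C') then set C' else insert N (set C'))"
    "length xs = card S"
    using assms N card by (auto simp: xs_def pad_def)
  have "card (S - set xs) = card (set xs - S)"
    using dom by (auto simp: xs_def dest: list_all2_lengthD)
  also have "set xs - S = (if card S = card (set C') then set C' - S else insert N (set C' - S))"
    using xs N by auto
  finally have pow: "(1 - t) ^ card (S - set xs) = u * (1 - t) ^ card (set C' - S)"
    using N card by (simp add: u_def)
  have "u * (\<Sum>C\<in>permutations_of_set S. list_sign C * pair_wt t C C') =
    (\<Sum>C\<in>permutations_of_set S. list_sign C *
     (\<Prod>i<length xs. entry_wt t (set (take i xs)) (xs ! i) (C ! i)))"
    unfolding sum_distrib_left
  proof (rule sum.cong[OF refl])
    fix C assume C: "C \<in> permutations_of_set S"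
    then have "length C = card S" "set C = S"
      by (auto simp: length_finite_permutations_of_set permutations_of_setD)
    then show "u * (list_sign C * pair_wt t C C') = list_sign C *
     (\<Prod>i<length xs. entry_wt t (set (take i xs)) (xs ! i) (C ! i))"
      using pair_wt_pad[of C C' N t] assms xs by (simp add: u_def xs_def mult.left_commute)
  qed
  also have "\<dots> = alt (row_wts t {} xs) S"
    using assms xs by (simp add: alt_row_wts_eq_sum)
  also have "\<dots> = list_sign xs * (u * transfer_coeff t N S (set C'))"
    using alt_row_wts_eval[OF assms(2) xs(1), of t] dom assms(2)
    by (simp add: xs_def[symmetric] transfer_coeff_def Let_def xs(2)[symmetric] pow mult.left_commute)
  also have "list_sign xs = (list_sign C' :: 'a)"
    using assms(4) list_sign_append_large[of C' N] by (auto simp: xs_def pad_def)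
  finally show ?thesis using assms(1) by (auto simp: u_def split: if_splits)
qed

section \<open>Ranks and dominance in decreasing lists\<close>

lemma card_greater_decreasing_list_nth:
  assumes "finite A" "k < card A"
  shows "card {y \<in> A. decreasing_list A ! k < y} = k"
proof -
  define l n where "l = decreasing_list A" and "n = card A"
  have l: "length l = n" "distinct l" "set l = A" "sorted_wrt (>) l"
    using assms by (simp_all add: l_def n_def)
  have less: "l ! k < l ! i \<longleftrightarrow> i < k" if "i < n" for i
  proof (cases i k rule: linorder_cases)
    case less
    then show ?thesis using sorted_wrt_nth_less[OF l(4), of i k] l(1) assms n_def by simp
  next
    case greater
    then show ?thesis using sorted_wrt_nth_less[OF l(4), of k i] l(1) that by simp
  qed simp
  have "{y \<in> A. l ! k < y} = (!) l ` {i. i < n \<and> l ! k < l ! i}"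
    unfolding l(3)[symmetric] using l(1) by (auto simp: in_set_conv_nth)
  also have "{i. i < n \<and> l ! k < l ! i} = {..<k}"
    using less assms(2) n_def by auto
  finally show ?thesis
    using l assms(2) by (simp add: card_image inj_on_nth l_def[symmetric] n_def)
qed

text \<open>An element stands at the position given by the number of larger elements; this is how
  \<open>hat_col\<close> indexes the vacated rows.\<close>

lemma decreasing_list_index:
  assumes "finite A" "x \<in> A"
  shows "card {y \<in> A. x < y} < card A" "decreasing_list A ! card {y \<in> A. x < y} = x"
proof -
  obtain k where "k < card A" "decreasing_list A ! k = x"
    using assms by (metis decreasing_list(1,3) in_set_conv_nth)
  with card_greater_decreasing_list_nth[of A k] assms(1)
  show "card {y \<in> A. x < y} < card A" "decreasing_list A ! card {y \<in> A. x < y} = x" by auto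
qed

text \<open>Otherwise let \<open>v\<close> at the 0-based position \<open>k\<close> of the first
  list exceed its partner \<open>w\<close>. Then at least \<open>k + 1\<close> elements of
  \<open>set s - set x\<close>, but at most \<open>k\<close> of \<open>set x - set s\<close>, are at
  least \<open>v\<close>. Adding the common elements, \<open>s\<close> has more entries at least
  \<open>v\<close> than \<open>x\<close>, against the rowwise bound.\<close>

lemma decreasing_list_dominance:
  assumes "distinct s" "distinct x" "length s = length x" "\<And>i. i < length s \<Longrightarrow> s ! i \<le> x ! i"
  shows "list_all2 (<) (decreasing_list (set s - set x)) (decreasing_list (set x - set s))"
proof -
  let ?B = "set s - set x" and ?D = "set x - set s"
  have "card ?B = card ?D"
    using assms distinct_card[of s] distinct_card[of x]
    by (simp add: card_Diff_subset_Int Int_commute)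
  moreover have "decreasing_list ?B ! k < decreasing_list ?D ! k" if k: "k < card ?B" for k
  proof (rule ccontr)
    define v where "v = decreasing_list ?B ! k"
    define w where "w = decreasing_list ?D ! k"
    assume "\<not> decreasing_list ?B ! k < decreasing_list ?D ! k"
    then have "\<not> v < w" by (simp add: v_def w_def)
    moreover have v: "v \<in> ?B" using k by (metis v_def decreasing_list(1,3) finite_Diff finite_set nth_mem)
    moreover have w: "w \<in> ?D" using k \<open>card ?B = card ?D\<close>
      by (metis w_def decreasing_list(1,3) finite_Diff finite_set nth_mem)
    ultimately have "w < v" by (metis Diff_iff linorder_neqE_nat)
    have geq: "card {y \<in> set zs. v \<le> y} = card {i. i < length zs \<and> v \<le> zs ! i}" if "distinct zs" for zs
    proof -
      have "{y \<in> set zs. v \<le> y} = (!) zs ` {i. i < length zs \<and> v \<le> zs ! i}"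
        by (auto simp: in_set_conv_nth)
      then show ?thesis using that by (simp add: card_image inj_on_nth)
    qed
    have split: "card {y \<in> P. v \<le> y} = card {y \<in> P - Q. v \<le> y} + card {y \<in> P \<inter> Q. v \<le> y}"
      if "finite P" for P Q
    proof -
      have "{y \<in> P. v \<le> y} = {y \<in> P - Q. v \<le> y} \<union> {y \<in> P \<inter> Q. v \<le> y}" by auto
      then show ?thesis using that by (subst card_Un_disjoint[symmetric]) auto
    qed
    have "card {i. i < length s \<and> v \<le> s ! i} \<le> card {i. i < length x \<and> v \<le> x ! i}"
      using assms by (intro card_mono) (auto intro: order_trans)
    then have "card {y \<in> ?B. v \<le> y} \<le> card {y \<in> ?D. v \<le> y}"
      using split[of "set s" "set x"] split[of "set x" "set s"] assms
      by (simp add: geq Int_commute)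
    also have "\<dots> \<le> card {y \<in> ?D. w < y}"
      using \<open>w < v\<close> by (intro card_mono) auto
    also have "\<dots> = k"
      using card_greater_decreasing_list_nth[of ?D k] k \<open>card ?B = card ?D\<close> by (simp add: w_def)
    also have "\<dots> = card {y \<in> ?B. v < y}"
      using card_greater_decreasing_list_nth[of ?B k] k by (simp add: v_def)
    also have "\<dots> < card {y \<in> ?B. v \<le> y}"
      using v by (intro psubset_card_mono) auto
    finally show False by simp
  qed
  ultimately show ?thesis by (simp add: list_all2_conv_all_nth)
qed

section \<open>Pivot rows\<close>

text \<open>For \<open>b' < b\<close> and \<open>d' < d\<close> the intervals \<open>[b, d]\<close>
  and \<open>[b', d']\<close> are disjoint exactly if \<open>d' < b\<close>, which is the comparison
  made by \<open>interlaced\<close>.\<close>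

lemma interlaced_iff_disjoint:
  assumes "list_all2 (<) Bs Ds" "sorted_wrt (>) Bs" "sorted_wrt (>) Ds"
  shows "interlaced Bs Ds \<longleftrightarrow> (\<forall>p \<in> set (zip Bs Ds). \<forall>q \<in> set (zip Bs Ds).
     p \<noteq> q \<longrightarrow> {fst p..snd p} \<inter> {fst q..snd q} = {})"
  using assms
proof (induction Bs Ds rule: list_all2_induct)
  case (Cons b Bs d Ds)
  have zip: "\<exists>b'. (b', d') \<in> set (zip Bs Ds)" if "d' \<in> set Ds" for d'
    using that list_all2_lengthD[OF Cons.hyps(2)] by (metis in_set_impl_in_set_zip2)
  have pair: "b' < b \<and> d' < d \<and> b' < d'" if "(b', d') \<in> set (zip Bs Ds)" for b' d'
    using that Cons.prems Cons.hyps by (auto simp: list_all2_iff dest: set_zip_leftD set_zip_rightD)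
  have int: "{b..d} \<inter> {b'..d'} = {} \<longleftrightarrow> d' < b" if "(b', d') \<in> set (zip Bs Ds)" for b' d'
    using pair[OF that] Cons.hyps(1) by (auto simp: Int_atLeastAtMost)
  have "(\<forall>d' \<in> set Ds. d' < b) \<longleftrightarrow> (\<forall>q \<in> set (zip Bs Ds). {b..d} \<inter> {fst q..snd q} = {})"
    using zip int by (fastforce dest: set_zip_rightD)
  moreover have "(b, d) \<notin> set (zip Bs Ds)" using pair by blast
  ultimately show ?case
    using Cons.IH Cons.prems by (auto simp: Int_commute)
qed auto

text \<open>The assumption \<open>dom\<close> carries the semistandardness. It depends only on the
  two sets of entries, so the locale applies to every arrangement \<open>C'\<close> of the right
  column, in particular to the root column.\<close>

locale column_pair =
  fixes N :: nat and C' :: "nat list" and S :: "nat set"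
  assumes fin: "finite S" and dist: "distinct C'" and bound: "S \<union> set C' \<subseteq> {..<N}"
    and size: "card S = length C' \<or> card S = Suc (length C')"
    and dom: "list_all2 (<) (decreasing_list (S - set (pad N (card S) C')))
            (decreasing_list (set (pad N (card S) C') - S))"
begin

definition "xs = pad N (card S) C'"
definition "Bs = decreasing_list (S - set xs)"
definition "Ds = decreasing_list (set xs - S)"
definition "Ch = hat_col C' S (card S)"

lemma N_notin: "N \<notin> S" "N \<notin> set C'"
  using bound by auto

lemma xs: "length xs = card S" "distinct xs" "r < length C' \<Longrightarrow> xs ! r = C' ! r"
  "card S = Suc (length C') \<Longrightarrow> xs ! length C' = N"
  "S \<inter> set xs = S \<inter> set C'" "S - set xs = S - set C'"
  using size dist N_notin by (auto simp: xs_def pad_def nth_append)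

lemma set_xs: "set xs - S = (if card S = length C' then set C' - S else insert N (set C' - S))"
  using N_notin by (auto simp: xs_def pad_def)

lemma BD: "set Bs = S - set xs" "set Ds = set xs - S" "length Bs = length Ds" "list_all2 (<) Bs Ds"
  "sorted_wrt (>) Bs" "sorted_wrt (>) Ds" "distinct Bs" "distinct Ds" "length Ds = card (set xs - S)"
  using fin dom by (auto simp: Bs_def Ds_def xs_def dest: list_all2_lengthD)

definition idx where "idx r = card {y \<in> set xs - S. xs ! r < y}"

lemma idx: "r < card S \<Longrightarrow> xs ! r \<notin> S \<Longrightarrow> idx r < length Ds"
  "r < card S \<Longrightarrow> xs ! r \<notin> S \<Longrightarrow> Ds ! idx r = xs ! r"
  using decreasing_list_index[of "set xs - S" "xs ! r"] xs(1) BD by (auto simp: idx_def Ds_def)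

lemma length_Ch: "length Ch = card S"
  by (simp add: Ch_def hat_col_def Let_def)

text \<open>After padding, the hat construction has a single rule: common entries stay, and the row
  holding the \<open>k\<close>-th largest element of \<open>set xs - S\<close> receives the
  \<open>k\<close>-th largest element of \<open>S - set xs\<close>. The extra row holds
  \<open>N\<close>, so it receives the maximum.\<close>

lemma Ch_nth:
  assumes "r < card S"
  shows "Ch ! r = (if xs ! r \<in> S then xs ! r else Bs ! idx r)"
proof (cases "r < length C'")
  case True
  show ?thesis
  proof (cases "card S = length C'")
    case eq: True
    then have "set xs = set C'" by (simp add: xs_def pad_def)
    then show ?thesis using True eq assms xs
      by (simp add: Ch_def hat_col_def Let_def Bs_def decreasing_list_def idx_def)
  next
    case False
    \<comment> \<open>\<open>N\<close> ranks before all entries of \<open>C'\<close>; this shift by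
      one accounts for the \<open>tl\<close> in \<open>hat_col\<close>.\<close>
    have *: "idx r = Suc (card {y \<in> set C' - S. C' ! r < y})"
    proof -
      have "C' ! r < N" using bound nth_mem[OF True] by auto
      then have "{y \<in> set xs - S. xs ! r < y} = insert N {y \<in> set C' - S. C' ! r < y}"
        using False True xs(3) unfolding set_xs by auto
      then show ?thesis using N_notin by (simp add: idx_def)
    qed
    have "idx r < length Bs" if "C' ! r \<notin> S"
      using idx(1)[OF assms] that True xs(3) BD by simp
    then have "Bs ! idx r = tl Bs ! card {y \<in> set C' - S. C' ! r < y}" if "C' ! r \<notin> S"
      using that * by (simp add: nth_tl)
    then show ?thesis
      using True False assms xs size
      by (auto simp: Ch_def hat_col_def Let_def Bs_def decreasing_list_def nth_append
          set_diff_eq[symmetric])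
  qed
next
  case False
  with size assms have r: "r = length C'" "card S = Suc (length C')" by auto
  then have xr: "xs ! r = N" using xs(4) by simp
  have e: "{y \<in> set xs - S. N < y} = {}"
    using bound by (auto simp: xs_def pad_def)
  have "idx r = 0" by (simp only: idx_def xr e card.empty)
  moreover have "Bs \<noteq> []"
    using idx(1)[OF assms] xr N_notin BD(3) by auto
  ultimately show ?thesis
    using r xr N_notin assms xs(6)
    by (simp add: Ch_def hat_col_def Let_def Bs_def decreasing_list_def hd_conv_nth nth_append)
qed

text \<open>A row with a common entry has equality, and a vacated row has \<open>b < d\<close> by
  \<open>dom\<close>. The row past the end of \<open>C'\<close> counts as vacated since
  \<open>N\<close> is not in \<open>S\<close>.\<close>

lemma pivots_eq: "pivots Ch C' = {r. r < card S \<and> xs ! r \<notin> S}"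
proof -
  have lt: "Ch ! r < xs ! r" if "r < card S" "xs ! r \<notin> S" for r
    using that Ch_nth idx[OF that] BD(4) by (auto simp: list_all2_conv_all_nth)
  show ?thesis
  proof (intro set_eqI iffI)
    fix r assume "r \<in> pivots Ch C'"
    then have "(r < length C' \<and> Ch ! r < C' ! r) \<or> (r = length C' \<and> length C' < card S)"
      by (simp add: pivots_def is_pivot_def length_Ch)
    then show "r \<in> {r. r < card S \<and> xs ! r \<notin> S}"
      using size Ch_nth xs(3,4) N_notin by (auto split: if_splits)
  next
    fix r assume "r \<in> {r. r < card S \<and> xs ! r \<notin> S}"
    then show "r \<in> pivots Ch C'"
      using lt[of r] size xs(3) by (cases "r < length C'") (auto simp: pivots_def is_pivot_def length_Ch)
  qed
qed

text \<open>Ordering the pivot rows by their rank \<open>idx\<close> instead of their height turns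
  them into the matched pairs of \<open>Bs\<close> and \<open>Ds\<close>.\<close>

lemma bij_pivots: "bij_betw (\<lambda>r. (Ch ! r, xs ! r)) (pivots Ch C') (set (zip Bs Ds))"
proof (rule bij_betw_imageI)
  show "inj_on (\<lambda>r. (Ch ! r, xs ! r)) (pivots Ch C')"
    using xs(1,2) by (auto simp: inj_on_def pivots_eq nth_eq_iff_index_eq)
  have fwd: "(Ch ! r, xs ! r) = (Bs ! idx r, Ds ! idx r)" "idx r < length Ds" if "r \<in> pivots Ch C'" for r
    using that Ch_nth idx by (auto simp: pivots_eq)
  show "(\<lambda>r. (Ch ! r, xs ! r)) ` pivots Ch C' = set (zip Bs Ds)"
  proof (intro set_eqI iffI)
    fix p assume "p \<in> (\<lambda>r. (Ch ! r, xs ! r)) ` pivots Ch C'"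
    then show "p \<in> set (zip Bs Ds)" using fwd BD(3) by (auto simp: set_zip)
  next
    fix p assume "p \<in> set (zip Bs Ds)"
    then obtain k where k: "k < length Ds" "p = (Bs ! k, Ds ! k)" using BD(3) by (auto simp: set_zip)
    then have "Ds ! k \<in> set xs - S" using BD(2) nth_mem by blast
    then obtain r where r: "r < card S" "xs ! r = Ds ! k" "xs ! r \<notin> S"
      using xs(1) by (auto simp: in_set_conv_nth)
    then have "idx r = k" using idx[OF r(1,3)] k BD(8) by (metis nth_eq_iff_index_eq)
    moreover have "r \<in> pivots Ch C'" using r by (simp add: pivots_eq)
    ultimately show "p \<in> (\<lambda>r. (Ch ! r, xs ! r)) ` pivots Ch C'"
      using fwd[of r] k by (intro image_eqI[of _ _ r]) auto
  qed
qed

lemma set_Ch: "set Ch = S"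
proof -
  have bij: "(\<lambda>r. Ch ! r) ` pivots Ch C' = set Bs"
  proof -
    have "(\<lambda>r. Ch ! r) ` pivots Ch C' = fst ` (\<lambda>r. (Ch ! r, xs ! r)) ` pivots Ch C'"
      by (simp add: image_image)
    also have "\<dots> = set Bs"
      using bij_pivots BD(3) by (simp add: bij_betw_def set_map[symmetric] del: set_map)
    finally show ?thesis .
  qed
  have "set Ch = (\<lambda>r. Ch ! r) ` {..<card S}"
    by (auto simp: set_conv_nth length_Ch)
  also have "{..<card S} = pivots Ch C' \<union> {r. r < card S \<and> xs ! r \<in> S}" by (auto simp: pivots_eq)
  also have "(\<lambda>r. Ch ! r) ` \<dots> = set Bs \<union> (\<lambda>r. xs ! r) ` {r. r < card S \<and> xs ! r \<in> S}"
    unfolding image_Un bij by (auto simp: Ch_nth intro!: image_cong)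
  also have "(\<lambda>r. xs ! r) ` {r. r < card S \<and> xs ! r \<in> S} = S \<inter> set xs"
    using xs(1) by (auto simp: in_set_conv_nth)
  finally show ?thesis using BD(1) by auto
qed

lemma distinct_Ch: "distinct Ch"
  using set_Ch length_Ch by (simp add: card_distinct)

lemma pivot_lt: "q \<in> pivots Ch C' \<Longrightarrow> xs ! q = C' ! q \<and> q < length C' \<and> C' ! q < N
    \<or> xs ! q = N \<and> q = length C'"
proof -
  have "C' ! q < N" if "q < length C'" using bound nth_mem[OF that] by auto
  then show "q \<in> pivots Ch C' \<Longrightarrow> ?thesis"
    using size xs(3,4) by (auto simp: pivots_eq less_Suc_eq)
qed

lemma non_overlapping_iff: "non_overlapping Ch C' \<longleftrightarrow> interlaced Bs Ds"
proof -
  \<comment> \<open>At most one of two distinct pivot rows is the padded one, and the interval of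
    the other ends below \<open>N\<close>. Cutting the infinite interval at \<open>N\<close>
    therefore keeps the intersection.\<close>
  have iv: "closed_iv Ch C' q1 \<inter> closed_iv Ch C' q2 = {Ch ! q1..xs ! q1} \<inter> {Ch ! q2..xs ! q2}"
    if "q1 \<in> pivots Ch C'" "q2 \<in> pivots Ch C'" "q1 \<noteq> q2" for q1 q2
    using pivot_lt[OF that(1)] pivot_lt[OF that(2)] that(3)
    by (auto simp: closed_iv_def)
  let ?f = "\<lambda>r. (Ch ! r, xs ! r)"
  have f: "set (zip Bs Ds) = ?f ` pivots Ch C'" "inj_on ?f (pivots Ch C')"
    using bij_pivots by (auto simp: bij_betw_def)
  have "non_overlapping Ch C' \<longleftrightarrow> (\<forall>q1 \<in> pivots Ch C'. \<forall>q2 \<in> pivots Ch C'. ?f q1 \<noteq> ?f q2 \<longrightarrow>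
     {fst (?f q1)..snd (?f q1)} \<inter> {fst (?f q2)..snd (?f q2)} = {})"
    unfolding non_overlapping_def
  proof (intro ball_cong refl)
    fix q1 q2 assume q: "q1 \<in> pivots Ch C'" "q2 \<in> pivots Ch C'"
    show "(q1 \<noteq> q2 \<longrightarrow> closed_iv Ch C' q1 \<inter> closed_iv Ch C' q2 = {}) \<longleftrightarrow>
      (?f q1 \<noteq> ?f q2 \<longrightarrow> {fst (?f q1)..snd (?f q1)} \<inter> {fst (?f q2)..snd (?f q2)} = {})"
    proof (cases "q1 = q2")
      case False
      then have "?f q1 \<noteq> ?f q2" using inj_onD[OF f(2) _ q] by blast
      then show ?thesis using False iv[OF q False] by simp
    qed simp
  qed
  then show ?thesis
    unfolding interlaced_iff_disjoint[OF BD(4-6)] f(1) by (simp only: ball_simps)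
qed

text \<open>The rows above and below \<open>q\<close> together are all rows, since \<open>q\<close>
  itself is excluded: its right neighbour is not in \<open>S\<close>. All entries of
  \<open>C'\<close> lie below \<open>N\<close>, so an infinite interval may again end there.\<close>

lemma N_sum: "N_check Ch C' + N_hat Ch C' = gap_count (S \<inter> set xs) Bs Ds"
proof -
  let ?P = "\<lambda>q r. r < length C' \<and> C' ! r \<in> set Ch \<and> C' ! r \<in> open_iv Ch C' q"
  have "card {r. q < r \<and> ?P q r} + card {r. r < q \<and> ?P q r} =
      card {a \<in> S \<inter> set xs. Ch ! q < a \<and> a < xs ! q}" if q: "q \<in> pivots Ch C'" for q
  proof -
    have neq: "r \<noteq> q" if "?P q r" for r
      using q that set_Ch xs(3) by (auto simp: pivots_eq)
    have "card {r. q < r \<and> ?P q r} + card {r. r < q \<and> ?P q r} =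
       card ({r. q < r \<and> ?P q r} \<union> {r. r < q \<and> ?P q r})"
      by (subst card_Un_disjoint) auto
    also have "{r. q < r \<and> ?P q r} \<union> {r. r < q \<and> ?P q r} = {r. ?P q r}"
      using neq by (auto simp: neq_iff)
    also have "card {r. ?P q r} = card ((!) C' ` {r. ?P q r})"
      using dist by (intro card_image[symmetric] inj_on_nth) auto
    also have "(!) C' ` {r. ?P q r} = {a \<in> S \<inter> set C'. a \<in> open_iv Ch C' q}"
      by (auto simp: set_Ch in_set_conv_nth)
    also have "\<dots> = {a \<in> S \<inter> set xs. Ch ! q < a \<and> a < xs ! q}"
      using pivot_lt[OF q] bound unfolding xs(5) open_iv_def by auto
    finally show ?thesis .
  qed
  then have "N_check Ch C' + N_hat Ch C' =
    (\<Sum>q \<in> pivots Ch C'. card {a \<in> S \<inter> set xs. Ch ! q < a \<and> a < xs ! q})"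
    by (simp add: N_check_def N_hat_def sum.distrib[symmetric])
  also have "\<dots> = (\<Sum>(b, d) \<in> set (zip Bs Ds). card {a \<in> S \<inter> set xs. b < a \<and> a < d})"
    using sum.reindex_bij_betw[OF bij_pivots, of "\<lambda>(b, d). card {a \<in> S \<inter> set xs. b < a \<and> a < d}"]
    by simp
  also have "\<dots> = gap_count (S \<inter> set xs) Bs Ds"
    unfolding gap_count_def using BD(7)
    by (intro sum.distinct_set_conv_list) (simp add: distinct_zipI1)
  finally show ?thesis .
qed

lemma p_count: "p_count Ch C' = card (set C' - S)"
proof -
  have "{r. r < length C' \<and> Ch ! r < C' ! r} = {r. r < length C' \<and> C' ! r \<notin> S}"
  proof (intro Collect_cong conj_cong refl)
    fix r assume r: "r < length C'"
    then have "r \<in> pivots Ch C' \<longleftrightarrow> Ch ! r < C' ! r" by (auto simp: pivots_def is_pivot_def)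
    with r show "Ch ! r < C' ! r \<longleftrightarrow> C' ! r \<notin> S"
      using size xs(3)[OF r] by (auto simp: pivots_eq)
  qed
  moreover have "set C' - S = (!) C' ` {r. r < length C' \<and> C' ! r \<notin> S}"
    by (auto simp: in_set_conv_nth)
  ultimately show ?thesis
    using dist by (simp add: p_count_def card_image inj_on_nth)
qed

lemma transfer_coeff_hat:
  "transfer_coeff t N S (set C') = (if non_overlapping Ch C'
     then (- t) ^ (N_check Ch C' + N_hat Ch C') * (1 - t) ^ p_count Ch C' else 0)"
proof -
  have "set xs = (if card S = card (set C') then set C' else insert N (set C'))"
    using distinct_card[OF dist] by (auto simp: xs_def pad_def)
  then show ?thesis
    by (simp add: transfer_coeff_def Let_def non_overlapping_iff N_sum p_count Bs_def Ds_def)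
qed

end

section \<open>Fillings as sequences of columns\<close>

lemma list_sign_eq_power:
  assumes "distinct xs"
  shows "list_sign xs = (-1) ^ card {(i, j). i < j \<and> j < length xs \<and> xs ! j < xs ! i}"
  using assms
proof (induction xs)
  case (Cons x xs)
  let ?I = "\<lambda>xs. {(i, j). i < j \<and> j < length xs \<and> xs ! j < xs ! i}"
  let ?J = "{j. j < length xs \<and> xs ! j < x}"
  have fin: "finite (?I xs)"
    by (rule finite_subset[of _ "{..<length xs} \<times> {..<length xs}"]) auto
  have "?I (x # xs) = (\<lambda>j. (0, Suc j)) ` ?J \<union> map_prod Suc Suc ` ?I xs" (is "_ = ?A \<union> ?B")
  proof (intro set_eqI iffI)
    fix p assume "p \<in> ?I (x # xs)"
    then obtain i j' where *: "p = (i, j')" "i < j'" "j' < length (x # xs)" "(x # xs) ! j' < (x # xs) ! i"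
      by blast
    moreover from *(2) obtain j where "j' = Suc j" by (cases j') auto
    ultimately have p: "p = (i, Suc j)" "i < Suc j" "j < length xs" "xs ! j < (x # xs) ! i"
      by simp_all
    show "p \<in> ?A \<union> ?B"
    proof (cases i)
      case (Suc i')
      then have "p = map_prod Suc Suc (i', j)" "(i', j) \<in> ?I xs" using p by auto
      then show ?thesis by blast
    qed (use p in auto)
  qed auto
  moreover have "?A \<inter> ?B = {}" by auto
  ultimately have "card (?I (x # xs)) = card ?A + card ?B"
    using fin by (simp add: card_Un_disjoint)
  also have "card ?A = card ?J" by (intro card_image inj_onI) simp
  also have "card ?B = card (?I xs)" by (intro card_image inj_onI) auto
  also have "card ?J = card ((!) xs ` ?J)"
    using Cons.prems by (intro card_image[symmetric] inj_on_nth) auto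
  also have "(!) xs ` ?J = {y \<in> set xs. y < x}" by (auto simp: in_set_conv_nth)
  finally show ?case using Cons by (simp add: power_add)
qed auto

text \<open>These are the conditions of \<open>fillings\<close> that link two neighbouring columns;
  distinctness within a column is left to \<open>arrangements\<close>.\<close>

definition compatible :: "nat list \<Rightarrow> nat list \<Rightarrow> bool" where
  "compatible C C' \<longleftrightarrow> (\<forall>i<length C. (\<forall>k<i. k < length C' \<longrightarrow> C ! i \<noteq> C' ! k) \<and>
     (i < length C' \<longrightarrow> C ! i \<le> C' ! i))"

definition inv_pairs :: "nat list \<Rightarrow> nat list \<Rightarrow> (nat \<times> nat) set" where
  "inv_pairs C C' = {(i, k). i < length C \<and> k < i \<and> k < length C' \<and>
     (if i < length C' then C ! i < C' ! k \<and> C' ! k < C' ! i else C ! i < C' ! k)}"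

definition des_rows :: "nat list \<Rightarrow> nat list \<Rightarrow> nat set" where
  "des_rows C C' = {i. i < length C \<and> i < length C' \<and> C ! i < C' ! i}"

lemma finite_inv_pairs [simp]: "finite (inv_pairs C C')"
  by (rule finite_subset[of _ "{..<length C} \<times> {..<length C'}"]) (auto simp: inv_pairs_def)

lemma finite_des_rows [simp]: "finite (des_rows C C')"
  by (simp add: des_rows_def)

lemma pair_wt_eq:
  assumes "distinct C'" "length C \<le> Suc (length C')"
  shows "pair_wt t C C' = (if compatible C C'
     then t ^ card (inv_pairs C C') * (1 - t) ^ card (des_rows C C') else 0)"
proof -
  define ok where "ok i \<longleftrightarrow> (\<forall>k<i. k < length C' \<longrightarrow> C ! i \<noteq> C' ! k) \<and> (i < length C' \<longrightarrow> C ! i \<le> C' ! i)" for i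
  define K where "K i = {k. k < i \<and> k < length C' \<and>
     (if i < length C' then C ! i < C' ! k \<and> C' ! k < C' ! i else C ! i < C' ! k)}" for i
  define d :: "nat \<Rightarrow> nat" where "d i = of_bool (i < length C' \<and> C ! i < C' ! i)" for i
  have inj: "inj_on ((!) C') (K i)" for i
    using assms by (intro inj_on_nth) (auto simp: K_def)
  have row: "(if i < length C' then entry_wt t (set (take i C')) (C' ! i) (C ! i)
     else if C ! i \<in> set C' then 0 else t ^ card {y \<in> set C'. C ! i < y}) =
     (if ok i then t ^ card (K i) * (1 - t) ^ d i else 0)" if "i < length C" for i
  proof (cases "i < length C'")
    case True
    have mem: "y \<in> set (take i C') \<longleftrightarrow> (\<exists>k<i. y = C' ! k)" for y
      using True by (auto simp: in_set_conv_nth)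
    have "{y \<in> set (take i C'). C ! i < y \<and> y < C' ! i} = (!) C' ` K i"
      using True by (auto simp: mem K_def)
    then have "card {y \<in> set (take i C'). C ! i < y \<and> y < C' ! i} = card (K i)"
      using inj by (simp add: card_image)
    moreover have "C ! i \<le> C' ! i \<and> C ! i \<notin> set (take i C') \<longleftrightarrow> ok i"
      using True by (auto simp: mem ok_def)
    ultimately show ?thesis using True by (simp add: entry_wt_def d_def)
  next
    case False
    \<comment> \<open>\<open>C\<close> is at most one longer than \<open>C'\<close>, so this row
      comes directly after \<open>C'\<close> and all of \<open>C'\<close> lies above it.\<close>
    then have i: "i = length C'" using that assms by simp
    have mem: "y \<in> set C' \<longleftrightarrow> (\<exists>k<i. y = C' ! k)" for y
      using i by (auto simp: in_set_conv_nth)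
    have "{y \<in> set C'. C ! i < y} = (!) C' ` K i"
      using i by (auto simp: mem K_def)
    then have "card {y \<in> set C'. C ! i < y} = card (K i)"
      using inj by (simp add: card_image)
    moreover have "C ! i \<notin> set C' \<longleftrightarrow> ok i"
      using i by (auto simp: mem ok_def)
    ultimately show ?thesis using i by (auto simp: d_def)
  qed
  have "pair_wt t C C' = (\<Prod>i<length C. if ok i then t ^ card (K i) * (1 - t) ^ d i else 0)"
    unfolding pair_wt_def using row by (intro prod.cong) auto
  also have "\<dots> = (if compatible C C' then t ^ (\<Sum>i<length C. card (K i)) * (1 - t) ^ (\<Sum>i<length C. d i) else 0)"
  proof (cases "compatible C C'")
    case True
    then have "ok i" if "i < length C" for i using that by (auto simp: compatible_def ok_def)
    then show ?thesis using True by (simp add: prod.distrib power_sum)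
  next
    case False
    then obtain i where "i < length C" "\<not> ok i" by (auto simp: compatible_def ok_def)
    then have "(\<Prod>i<length C. if ok i then t ^ card (K i) * (1 - t) ^ d i else 0) = 0"
      by (intro prod_zero) auto
    then show ?thesis using False by simp
  qed
  also have "(\<Sum>i<length C. card (K i)) = card (inv_pairs C C')"
  proof -
    have "inv_pairs C C' = (SIGMA i:{..<length C}. K i)" by (auto simp: inv_pairs_def K_def)
    then show ?thesis by (simp add: K_def)
  qed
  also have "(\<Sum>i<length C. d i) = card (des_rows C C')"
    by (simp add: d_def des_rows_def sum.If_cases Int_def lessThan_def of_bool_def)
  finally show ?thesis .
qed

text \<open>Each transfer replaces the sum over a column by a constant and hands its sign to the
  next column. The weight \<open>h\<close> of the last column is arbitrary so that the induction can
  absorb the factor \<open>W\<close> linking it to one more column.\<close>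

lemma chain_sum:
  fixes P :: "nat \<Rightarrow> nat list set" and W :: "nat list \<Rightarrow> nat list \<Rightarrow> 'a::comm_ring_1"
  assumes transfer: "\<And>k C'. \<lbrakk>1 \<le> k; k < m; C' \<in> P (Suc k)\<rbrakk> \<Longrightarrow>
        (\<Sum>C\<in>P k. list_sign C * W C C') = list_sign C' * K k"
    and "1 \<le> k" "k \<le> m"
  shows "(\<Sum>cs\<in>PiE {1..k} P. list_sign (cs 1) * (\<Prod>j\<in>{1..<k}. W (cs j) (cs (Suc j))) * h (cs k)) =
     (\<Prod>j\<in>{1..<k}. K j) * (\<Sum>C\<in>P k. list_sign C * h C)"
  using assms(2,3)
proof (induction k arbitrary: h rule: dec_induct)
  case base
  have "(\<Sum>cs\<in>PiE {1..1} P. list_sign (cs 1) * h (cs 1)) = (\<Sum>C\<in>P 1. list_sign C * h C)"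
    by (rule sum.reindex_bij_witness[of _ "\<lambda>C. \<lambda>j\<in>{1}. C" "\<lambda>cs. cs 1"])
      (auto simp: PiE_iff extensional_def fun_eq_iff)
  then show ?case by simp
next
  case (step k)
  let ?f = "\<lambda>cs. list_sign (cs 1) * (\<Prod>j\<in>{1..<Suc k}. W (cs j) (cs (Suc j))) * h (cs (Suc k))"
  have k: "{1..Suc k} = insert (Suc k) {1..k}" using step.hyps by auto
  have "sum ?f (PiE {1..Suc k} P) =
    (\<Sum>(C', cs) \<in> P (Suc k) \<times> PiE {1..k} P. ?f (cs(Suc k := C')))"
  proof -
    have "inj_on (\<lambda>(C', cs). cs(Suc k := C')) (P (Suc k) \<times> PiE {1..k} P)"
      by (rule inj_combinator) simp
    then show ?thesis
      unfolding k PiE_insert_eq by (subst sum.reindex) (simp_all only: comp_def case_prod_unfold)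
  qed
  also have "\<dots> = (\<Sum>C' \<in> P (Suc k). \<Sum>cs \<in> PiE {1..k} P.
     list_sign (cs 1) * (\<Prod>j\<in>{1..<k}. W (cs j) (cs (Suc j))) * (W (cs k) C' * h C'))"
    unfolding sum.cartesian_product[symmetric]
  proof (intro sum.cong refl)
    fix C' cs
    have "(\<Prod>j\<in>{1..<Suc k}. W ((cs(Suc k := C')) j) ((cs(Suc k := C')) (Suc j))) =
       (\<Prod>j\<in>{1..<k}. W (cs j) (cs (Suc j))) * W (cs k) C'"
      using step.hyps by (simp add: prod.atLeastLessThan_Suc)
    then show "?f (cs(Suc k := C')) =
        list_sign (cs 1) * (\<Prod>j\<in>{1..<k}. W (cs j) (cs (Suc j))) * (W (cs k) C' * h C')"
      using step.hyps by (simp add: mult.assoc)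
  qed
  also have "\<dots> = (\<Sum>C' \<in> P (Suc k). (\<Prod>j\<in>{1..<k}. K j) * ((\<Sum>C\<in>P k. list_sign C * W C C') * h C'))"
    using step by (subst step.IH) (simp_all add: sum_distrib_right mult.assoc)
  also have "\<dots> = (\<Prod>j\<in>{1..<Suc k}. K j) * (\<Sum>C\<in>P (Suc k). list_sign C * h C)"
    using step by (simp add: transfer sum_distrib_left prod.atLeastLessThan_Suc mult.assoc mult.left_commute cong: sum.cong)
  finally show ?case .
qed

text \<open>The shape enters through these facts only; \<open>tableau_mu_of\<close> derives them for
  \<open>\<lambda> + \<rho>\<close>. The bounds on column lengths fit \<open>column_pair\<close>,
  and the single cell of the last column ends the chain of transfers.\<close>

locale tableau =
  fixes mu :: "nat \<Rightarrow> nat" and n :: nat and \<sigma> :: filling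
  assumes cell_iff: "is_cell mu (i, j) \<longleftrightarrow> 1 \<le> j \<and> 1 \<le> i \<and> i \<le> col_len mu j"
    and col_len_step: "1 \<le> j \<Longrightarrow> col_len mu (Suc j) \<le> col_len mu j"
      "1 \<le> j \<Longrightarrow> col_len mu j \<le> Suc (col_len mu (Suc j))"
    and col_len_last: "col_len mu (mu 1) = 1" and width_pos: "1 \<le> mu 1"
    and ssyt: "is_ssyt mu n \<sigma>"
begin

abbreviation "m \<equiv> mu 1"
abbreviation "len \<equiv> col_len mu"
definition "entries j = set (col mu \<sigma> j)"
definition "arrangements j = permutations_of_set (entries j)"

lemma length_col [simp]: "length (col mu T j) = len j"
  by (simp add: col_def)

lemma col_nth [simp]: "i < len j \<Longrightarrow> col mu T j ! i = T (Suc i, j)"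
  by (simp add: col_def nth_Cons' del: upt_Suc)

lemma cell_Suc: "1 \<le> j \<Longrightarrow> is_cell mu (Suc i, j) \<longleftrightarrow> i < len j"
  by (simp add: cell_iff Suc_le_eq)

lemma cell_col_le: "is_cell mu (i, j) \<Longrightarrow> j \<le> m"
proof -
  assume "is_cell mu (i, j)"
  then have "is_cell mu (1, j)" using cell_iff[of i j] cell_iff[of 1 j] by simp
  then show ?thesis by (simp add: is_cell_def)
qed

lemma sorted_col: "1 \<le> j \<Longrightarrow> sorted_wrt (<) (col mu \<sigma> j)"
proof -
  assume j: "1 \<le> j"
  have "\<sigma> (Suc i, j) < \<sigma> (Suc (Suc i), j)" if "Suc i < len j" for i
    using ssyt that cell_Suc[OF j] by (auto simp: is_ssyt_def)
  then have "sorted_wrt (<) (col mu \<sigma> j) \<longleftrightarrow> True"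
    by (subst sorted_wrt_iff_nth_Suc_transp) (auto simp: transp_def)
  then show ?thesis by simp
qed

lemma distinct_col: "1 \<le> j \<Longrightarrow> distinct (col mu \<sigma> j)"
  using sorted_col strict_sorted_iff by blast

lemma card_entries: "1 \<le> j \<Longrightarrow> card (entries j) = len j"
  using distinct_card[OF distinct_col] by (simp add: entries_def)

lemma finite_entries [simp]: "finite (entries j)"
  by (simp add: entries_def)

lemma entries_bound: "1 \<le> j \<Longrightarrow> entries j \<subseteq> {1..n}"
  using ssyt cell_Suc[of j] by (auto simp: entries_def in_set_conv_nth is_ssyt_def)

lemma arrangementsD: "C \<in> arrangements j \<Longrightarrow> set C = entries j \<and> distinct C"
  by (simp add: arrangements_def permutations_of_set_def)

lemma length_arrangement: "1 \<le> j \<Longrightarrow> C \<in> arrangements j \<Longrightarrow> length C = len j"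
  by (metis arrangementsD card_entries distinct_card)

lemma sort_eq_iff: "1 \<le> j \<Longrightarrow> sort (col mu T j) = col mu \<sigma> j \<longleftrightarrow> col mu T j \<in> arrangements j"
proof
  assume j: "1 \<le> j" and s: "sort (col mu T j) = col mu \<sigma> j"
  then show "col mu T j \<in> arrangements j"
    using distinct_col[OF j] by (metis arrangements_def distinct_sort entries_def permutations_of_setI set_sort)
next
  assume j: "1 \<le> j" and s: "col mu T j \<in> arrangements j"
  then have "set (sort (col mu T j)) = set (col mu \<sigma> j)" "distinct (sort (col mu T j))"
    using arrangementsD[OF s] by (auto simp: entries_def)
  then show "sort (col mu T j) = col mu \<sigma> j"
    using sorted_distinct_set_unique[of "sort (col mu T j)" "col mu \<sigma> j"]
      sorted_col[OF j] by (simp add: strict_sorted_iff)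
qed

lemma column_pair:
  assumes j: "1 \<le> j" and C': "set C' = entries (Suc j)" "distinct C'"
  shows "column_pair (Suc n) C' (entries j)"
proof
  \<comment> \<open>The rowwise comparison is made with the next column of \<open>\<sigma>\<close>
    itself, where semistandardness applies. Padded, it has the same entries as the padded
    \<open>C'\<close>.\<close>
  define x where "x = pad (Suc n) (len j) (col mu \<sigma> (Suc j))"
  have l: "length C' = len (Suc j)" using C' card_entries[of "Suc j"] by (simp add: distinct_card[symmetric])
  show bd: "entries j \<union> set C' \<subseteq> {..<Suc n}"
    using entries_bound[OF j] entries_bound[of "Suc j"] C' by auto
  show "card (entries j) = length C' \<or> card (entries j) = Suc (length C')"
    using col_len_step[OF j] card_entries[OF j] l by auto
  have x: "length x = len j" "set (pad (Suc n) (len j) C') = set x" "distinct x"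
    using col_len_step[OF j] l C' distinct_col[of "Suc j"] bd by (auto simp: x_def pad_def entries_def)
  have "col mu \<sigma> j ! i \<le> x ! i" if i: "i < len j" for i
  proof (cases "i < len (Suc j)")
    case True
    then show ?thesis
      using ssyt i cell_Suc[of j] cell_Suc[of "Suc j"] j by (auto simp: x_def pad_def nth_append is_ssyt_def)
  next
    case False
    then have "x ! i = Suc n" using i col_len_step[OF j] by (auto simp: x_def pad_def nth_append)
    moreover have "col mu \<sigma> j ! i \<in> entries j" using i by (metis entries_def length_col nth_mem)
    ultimately show ?thesis using entries_bound[OF j] by fastforce
  qed
  then have "list_all2 (<) (decreasing_list (set (col mu \<sigma> j) - set x)) (decreasing_list (set x - set (col mu \<sigma> j)))"
    using x distinct_col[OF j] by (intro decreasing_list_dominance) auto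
  then show "list_all2 (<)
     (decreasing_list (entries j - set (pad (Suc n) (card (entries j)) C')))
     (decreasing_list (set (pad (Suc n) (card (entries j)) C') - entries j))"
    unfolding card_entries[OF j] x(2) by (simp add: entries_def)
qed (use C' in auto)

text \<open>\<open>root_aux\<close> counts columns from the right, so index \<open>k\<close> means
  column \<open>m - k\<close>. Knowing its entries makes each root column admissible as right column
  in \<open>column_pair\<close>.\<close>

lemma root_aux_entries: "k < m \<Longrightarrow> set (root_aux mu \<sigma> k) = entries (m - k) \<and> distinct (root_aux mu \<sigma> k)"
proof (induction k)
  case 0
  then show ?case using distinct_col width_pos by (simp add: entries_def)
next
  case (Suc k)
  define j where "j = m - Suc k"
  have j: "1 \<le> j" "m - k = Suc j" using Suc.prems by (auto simp: j_def)
  interpret cp: column_pair "Suc n" "root_aux mu \<sigma> k" "entries j"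
    using Suc j by (intro column_pair) auto
  have "root_aux mu \<sigma> (Suc k) = cp.Ch"
    unfolding root_aux.simps j_def[symmetric] cp.Ch_def card_entries[OF j(1)] entries_def[symmetric] ..
  then show ?case using cp.set_Ch cp.distinct_Ch by (simp add: j_def)
qed

text \<open>The coefficient depends only on the two sets, so the root column may represent the right
  one; the left root column is then its hat column.\<close>

lemma transfer_coeff_root:
  assumes "1 \<le> j" "j < m"
  shows "transfer_coeff t (Suc n) (entries j) (entries (Suc j)) =
    (let Ch = root_col mu \<sigma> j; C' = root_col mu \<sigma> (Suc j) in
     if non_overlapping Ch C' then (- t) ^ (N_check Ch C' + N_hat Ch C') * (1 - t) ^ p_count Ch C' else 0)"
proof -
  define k where "k = m - Suc j"
  have k: "k < m" "m - k = Suc j" "m - j = Suc k" "m - Suc k = j" using assms by (auto simp: k_def)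
  have root: "set (root_aux mu \<sigma> k) = entries (Suc j)" "distinct (root_aux mu \<sigma> k)"
    using root_aux_entries[OF k(1)] k by auto
  interpret cp: column_pair "Suc n" "root_aux mu \<sigma> k" "entries j"
    using assms root by (intro column_pair) auto
  have "root_col mu \<sigma> (Suc j) = root_aux mu \<sigma> k"
    by (simp add: root_col_def k_def)
  moreover have "root_col mu \<sigma> j = cp.Ch"
    unfolding root_col_def k(3) root_aux.simps k(4) cp.Ch_def card_entries[OF assms(1)]
      entries_def[symmetric] ..
  ultimately show ?thesis using cp.transfer_coeff_hat[of t] root by (simp add: Let_def)
qed

lemma sum_arrangements:
  fixes t :: "'a::{idom,ring_char_0}"
  assumes "t \<noteq> 1" "1 \<le> j" "C' \<in> arrangements (Suc j)"
  shows "(\<Sum>C\<in>arrangements j. list_sign C * pair_wt t C C') =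
    list_sign C' * transfer_coeff t (Suc n) (entries j) (entries (Suc j))"
proof -
  interpret cp: column_pair "Suc n" C' "entries j"
    using assms arrangementsD[OF assms(3)] by (intro column_pair) auto
  show ?thesis
    using sum_pair_wt[OF assms(1) cp.fin cp.dist cp.bound cp.size cp.dom] arrangementsD[OF assms(3)]
    by (simp add: arrangements_def)
qed

text \<open>Dropping all conditions between different columns makes the set a product over the
  columns, as \<open>chain_sum\<close> requires.\<close>

definition "raw_fillings = {T. (\<forall>u. \<not> is_cell mu u \<longrightarrow> T u = 0) \<and> (\<forall>j\<in>{1..m}. col mu T j \<in> arrangements j)}"

lemma raw_fillings_bij: "bij_betw (\<lambda>T. \<lambda>j\<in>{1..m}. col mu T j) raw_fillings (PiE {1..m} arrangements)"
proof (rule bij_betw_byWitness[where f' = "\<lambda>cs (i, j). if is_cell mu (i, j) then cs j ! (i - 1) else 0"])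
  let ?g = "\<lambda>cs (i, j). if is_cell mu (i, j) then cs j ! (i - 1) else (0::nat)"
  have col: "col mu (?g cs) j = cs j" if "cs \<in> PiE {1..m} arrangements" "j \<in> {1..m}" for cs j
  proof (rule nth_equalityI)
    have "length (cs j) = len j"
      using that by (intro length_arrangement) (auto simp: PiE_iff)
    then show "length (col mu (?g cs) j) = length (cs j)" by simp
    show "col mu (?g cs) j ! i = cs j ! i" if "i < length (col mu (?g cs) j)" for i
      using that \<open>j \<in> {1..m}\<close> cell_Suc[of j i] by simp
  qed
  show "\<forall>T\<in>raw_fillings. ?g (\<lambda>j\<in>{1..m}. col mu T j) = T"
  proof (intro ballI ext)
    fix T and u :: "nat \<times> nat" assume T: "T \<in> raw_fillings"
    obtain i j where u: "u = (i, j)" by force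
    show "?g (\<lambda>j\<in>{1..m}. col mu T j) u = T u"
    proof (cases "is_cell mu u")
      case True
      then have "j \<in> {1..m}" "i - 1 < len j" "Suc (i - 1) = i"
        using cell_col_le cell_iff[of i j] unfolding u by auto
      then show ?thesis using True u by simp
    qed (use T u in \<open>auto simp: raw_fillings_def\<close>)
  qed
  show "\<forall>cs\<in>PiE {1..m} arrangements. (\<lambda>j\<in>{1..m}. col mu (?g cs) j) = cs"
    using col by (auto simp: fun_eq_iff PiE_iff extensional_def)
  show "(\<lambda>T. \<lambda>j\<in>{1..m}. col mu T j) ` raw_fillings \<subseteq> PiE {1..m} arrangements"
    by (auto simp: raw_fillings_def)
  show "?g ` PiE {1..m} arrangements \<subseteq> raw_fillings"
    using col by (fastforce simp: raw_fillings_def)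
qed

lemma raw_fillingD:
  assumes "T \<in> raw_fillings"
  shows "\<not> is_cell mu u \<Longrightarrow> T u = 0"
    and "1 \<le> j \<Longrightarrow> j \<le> m \<Longrightarrow> set (col mu T j) = entries j \<and> distinct (col mu T j)"
  using assms arrangementsD[of "col mu T j" j]
  by (simp_all add: raw_fillings_def del: split_paired_All)

lemma cellE:
  assumes "is_cell mu u"
  obtains i j where "u = (Suc i, j)" "1 \<le> j" "j \<le> m" "i < len j"
proof -
  obtain a j where u: "u = (a, j)" by force
  with assms have "1 \<le> j" "1 \<le> a" "a \<le> len j" "j \<le> m"
    using cell_iff[of a j] cell_col_le[of a j] by auto
  then show ?thesis using that[of "a - 1" j] u by simp
qed

text \<open>The range of the entries and distinctness within columns are built into
  \<open>raw_fillings\<close>; each remaining condition links a column with the next.\<close>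

lemma fillings_iff_compatible:
  assumes T: "T \<in> raw_fillings"
  shows "T \<in> fillings mu n \<longleftrightarrow> (\<forall>j\<in>{1..<m}. compatible (col mu T j) (col mu T (Suc j)))"
proof
  assume F: "T \<in> fillings mu n"
  show "\<forall>j\<in>{1..<m}. compatible (col mu T j) (col mu T (Suc j))"
    unfolding compatible_def
  proof (intro ballI allI impI conjI)
    fix j i k assume "j \<in> {1..<m}" "i < length (col mu T j)" "k < i" "k < length (col mu T (Suc j))"
    moreover from this have "attack mu (Suc i, j) (Suc k, Suc j)" by (simp add: attack_def cell_Suc)
    ultimately show "col mu T j ! i \<noteq> col mu T (Suc j) ! k"
      using F by (simp add: fillings_def)
  next
    fix j i assume "j \<in> {1..<m}" "i < length (col mu T j)" "i < length (col mu T (Suc j))"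
    moreover from this have "is_cell mu (Suc i, j)" "is_cell mu (rcell (Suc i, j))"
      by (simp_all add: rcell_def cell_Suc)
    moreover from this have "T (Suc i, j) \<le> T (rcell (Suc i, j))" using F by (simp add: fillings_def)
    ultimately show "col mu T j ! i \<le> col mu T (Suc j) ! i" by (simp add: rcell_def)
  qed
next
  assume C: "\<forall>j\<in>{1..<m}. compatible (col mu T j) (col mu T (Suc j))"
  have next_col: "T (a, j) \<noteq> T (b, Suc j)" if c: "is_cell mu (a, j)" "is_cell mu (b, Suc j)" "b < a" for a b j
  proof -
    obtain i k where "a = Suc i" "b = Suc k" "1 \<le> j" "i < len j" "k < len (Suc j)" "k < i" "Suc j \<le> m"
      using c by (auto elim!: cellE)
    moreover from this C have "compatible (col mu T j) (col mu T (Suc j))" by simp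
    ultimately show ?thesis by (auto simp: compatible_def)
  qed
  have same_col: "T (a, j) \<noteq> T (b, j)" if c: "is_cell mu (a, j)" "is_cell mu (b, j)" "a \<noteq> b" for a b j
  proof -
    obtain i k where "a = Suc i" "b = Suc k" "1 \<le> j" "i < len j" "k < len j" "j \<le> m"
      using c(1,2) by (auto elim!: cellE)
    then show ?thesis
      using c(3) raw_fillingD(2)[OF T, of j] nth_eq_iff_index_eq[of "col mu T j" i k] by simp
  qed
  have "T u \<in> {1..n}" if "is_cell mu u" for u
    using that
  proof (rule cellE)
    fix i j assume "u = (Suc i, j)" "1 \<le> j" "j \<le> m" "i < len j"
    then show ?thesis
      using nth_mem[of i "col mu T j"] raw_fillingD(2)[OF T, of j] entries_bound[of j] by auto
  qed
  moreover have "T u \<noteq> T v" if "attack mu u v" for u v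
  proof -
    obtain a j b k where u: "u = (a, j)" "v = (b, k)" by (cases u, cases v) auto
    from that consider "is_cell mu u" "is_cell mu v" "j = k" "a \<noteq> b"
      | "is_cell mu u" "is_cell mu v" "k = Suc j" "b < a"
      | "is_cell mu u" "is_cell mu v" "j = Suc k" "a < b"
      unfolding attack_def u by auto
    then show ?thesis
    proof cases
      case 1 then show ?thesis using same_col u by simp
    next
      case 2 then show ?thesis using next_col u by simp
    next
      case 3 then show ?thesis using next_col[of b k a] u by simp
    qed
  qed
  moreover have "T u \<le> T (rcell u)" if "is_cell mu u" "is_cell mu (rcell u)" for u
    using that(1)
  proof (rule cellE)
    fix i j assume u: "u = (Suc i, j)" "1 \<le> j" "i < len j"
    with that(2) have "i < len (Suc j)" "Suc j \<le> m"
      using cell_Suc[of "Suc j" i] cell_col_le[of "Suc i" "Suc j"] by (auto simp: rcell_def)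
    then have "compatible (col mu T j) (col mu T (Suc j))" using C u by simp
    then show ?thesis using u \<open>i < len (Suc j)\<close> by (auto simp: compatible_def rcell_def)
  qed
  ultimately show "T \<in> fillings mu n"
    using raw_fillingD(1)[OF T] unfolding fillings_def by blast
qed

section \<open>Statistics of a filling as sums over adjacent columns\<close>

lemma inv_stat_eq: "inv_stat mu T = (\<Sum>j\<in>{1..<m}. card (inv_pairs (col mu T j) (col mu T (Suc j))))"
proof -
  let ?I = "SIGMA j:{1..<m}. inv_pairs (col mu T j) (col mu T (Suc j))"
  \<comment> \<open>From column, lower row, upper row (rows 0-based) to the order of
    \<open>inv_stat\<close>: upper row, lower row, column (rows 1-based).\<close>
  let ?f = "\<lambda>(j, i, k). (Suc k, Suc i, j)"
  let ?L = "{(i, j, k). is_cell mu (j, k) \<and> is_cell mu (i, Suc k) \<and> i < j \<and>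
     (if is_cell mu (j, Suc k)
      then T (j, k) < T (i, Suc k) \<and> T (i, Suc k) < T (j, Suc k)
      else T (j, k) < T (i, Suc k))}"
  have "?L = ?f ` ?I"
  proof (intro set_eqI iffI)
    fix p assume "p \<in> ?L"
    then obtain a b j where p: "p = (a, b, j)" "is_cell mu (b, j)" "is_cell mu (a, Suc j)" "a < b"
       "if is_cell mu (b, Suc j) then T (b, j) < T (a, Suc j) \<and> T (a, Suc j) < T (b, Suc j)
        else T (b, j) < T (a, Suc j)"
      by blast
    obtain i k where *: "b = Suc i" "a = Suc k" "1 \<le> j" "i < len j" "k < len (Suc j)" "k < i" "Suc j \<le> m"
      using p(2-4) by (auto elim!: cellE)
    then have "(j, i, k) \<in> ?I"
      using p(5) cell_Suc[of "Suc j" i] by (auto simp: inv_pairs_def split: if_splits)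
    then show "p \<in> ?f ` ?I" using p(1) * by (intro image_eqI[of _ _ "(j, i, k)"]) auto
  next
    fix p assume "p \<in> ?f ` ?I"
    then obtain j i k where "p = (Suc k, Suc i, j)" "j \<in> {1..<m}"
      "(i, k) \<in> inv_pairs (col mu T j) (col mu T (Suc j))" by auto
    then show "p \<in> ?L" by (auto simp: inv_pairs_def cell_Suc)
  qed
  moreover have "inj_on ?f ?I" by (auto simp: inj_on_def)
  ultimately show ?thesis
    by (simp add: inv_stat_def card_image)
qed

lemma des_stat_eq: "des_stat mu T = (\<Sum>j\<in>{1..<m}. card (des_rows (col mu T j) (col mu T (Suc j))))"
proof -
  let ?I = "SIGMA j:{1..<m}. des_rows (col mu T j) (col mu T (Suc j))"
  let ?f = "\<lambda>(j, i). (Suc i, j)"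
  let ?L = "{u. is_cell mu u \<and> is_cell mu (rcell u) \<and> T u < T (rcell u)}"
  have "?L = ?f ` ?I"
  proof (intro set_eqI iffI)
    fix u assume u: "u \<in> ?L"
    then have "is_cell mu u" by simp
    then obtain i j where *: "u = (Suc i, j)" "1 \<le> j" "i < len j" by (rule cellE)
    moreover have "i < len (Suc j)" "Suc j \<le> m"
      using u * cell_Suc[of "Suc j" i] cell_col_le[of "Suc i" "Suc j"] by (auto simp: rcell_def)
    ultimately have "(j, i) \<in> ?I" using u by (auto simp: des_rows_def rcell_def)
    then show "u \<in> ?f ` ?I" using * by (intro image_eqI[of _ _ "(j, i)"]) auto
  next
    fix u assume "u \<in> ?f ` ?I"
    then obtain j i where "u = (Suc i, j)" "j \<in> {1..<m}"
      "i \<in> des_rows (col mu T j) (col mu T (Suc j))" by auto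
    then show "u \<in> ?L" by (auto simp: des_rows_def cell_Suc rcell_def)
  qed
  moreover have "inj_on ?f ?I" by (auto simp: inj_on_def)
  ultimately show ?thesis
    by (simp add: des_stat_def card_image)
qed

lemma ell_first_eq:
  assumes "T \<in> raw_fillings"
  shows "(-1) ^ ell_first mu T = (list_sign (col mu T 1) :: 'a::comm_ring_1)"
proof -
  let ?I = "{(i, j). i < j \<and> j < length (col mu T 1) \<and> col mu T 1 ! j < col mu T 1 ! i}"
  have "{(i, j). 1 \<le> i \<and> i < j \<and> j \<le> len 1 \<and> T (j, 1) < T (i, 1)} = map_prod Suc Suc ` ?I" (is "?L = _")
  proof (intro set_eqI iffI)
    fix p assume "p \<in> ?L"
    then obtain a b where p: "p = (a, b)" "1 \<le> a" "a < b" "b \<le> len 1" "T (b, 1) < T (a, 1)" by blast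
    then have "(a - 1, b - 1) \<in> ?I" by auto
    then show "p \<in> map_prod Suc Suc ` ?I"
      using p by (intro image_eqI[of _ _ "(a - 1, b - 1)"]) auto
  qed auto
  then have "ell_first mu T = card ?I"
    by (simp add: ell_first_def card_image inj_on_def)
  then show ?thesis
    using raw_fillingD(2)[OF assms, of 1] width_pos by (simp add: list_sign_eq_power)
qed

lemma raw_filling_weight:
  fixes t :: "'a::comm_ring_1"
  assumes T: "T \<in> raw_fillings"
  shows "(\<Prod>j\<in>{1..<m}. pair_wt t (col mu T j) (col mu T (Suc j))) =
    (if T \<in> fillings mu n then t ^ inv_stat mu T * (1 - t) ^ des_stat mu T else 0)"
proof -
  have wt: "pair_wt t (col mu T j) (col mu T (Suc j)) =
     (if compatible (col mu T j) (col mu T (Suc j))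
      then t ^ card (inv_pairs (col mu T j) (col mu T (Suc j))) *
        (1 - t) ^ card (des_rows (col mu T j) (col mu T (Suc j))) else 0)"
    if "j \<in> {1..<m}" for j
    using that raw_fillingD(2)[OF T, of "Suc j"] col_len_step(2)[of j] by (intro pair_wt_eq) auto
  show ?thesis
  proof (cases "T \<in> fillings mu n")
    case True
    then have "\<forall>j\<in>{1..<m}. compatible (col mu T j) (col mu T (Suc j))"
      using fillings_iff_compatible[OF T] by simp
    then have "(\<Prod>j\<in>{1..<m}. pair_wt t (col mu T j) (col mu T (Suc j))) =
       (\<Prod>j\<in>{1..<m}. t ^ card (inv_pairs (col mu T j) (col mu T (Suc j))) *
        (1 - t) ^ card (des_rows (col mu T j) (col mu T (Suc j))))"
      using wt by (intro prod.cong) auto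
    then show ?thesis
      using True by (simp add: inv_stat_eq des_stat_eq prod.distrib power_sum)
  next
    case False
    then obtain j where "j \<in> {1..<m}" "\<not> compatible (col mu T j) (col mu T (Suc j))"
      using fillings_iff_compatible[OF T] by blast
    then have "(\<Prod>j\<in>{1..<m}. pair_wt t (col mu T j) (col mu T (Suc j))) = 0"
      using wt[of j] by (intro prod_zero) auto
    then show ?thesis using False by simp
  qed
qed

lemma sum_sort_inv:
  fixes t :: "'a::{idom,ring_char_0}"
  assumes "t \<noteq> 1"
  shows "(\<Sum>T\<in>sort_inv mu n \<sigma>. (-1) ^ ell_first mu T * t ^ inv_stat mu T * (1 - t) ^ des_stat mu T) =
    (\<Prod>j\<in>{1..<m}. transfer_coeff t (Suc n) (entries j) (entries (Suc j)))"
proof -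
  let ?P = "\<lambda>cs. \<Prod>j\<in>{1..<m}. pair_wt t (cs j) (cs (Suc j))"
  have sub: "sort_inv mu n \<sigma> = {T \<in> raw_fillings. T \<in> fillings mu n}"
    using sort_eq_iff by (auto simp: sort_inv_def raw_fillings_def fillings_def)
  have fin: "finite raw_fillings"
    using bij_betw_finite[OF raw_fillings_bij] by (simp add: finite_PiE arrangements_def)
  have "(\<Sum>T\<in>sort_inv mu n \<sigma>. (-1) ^ ell_first mu T * t ^ inv_stat mu T * (1 - t) ^ des_stat mu T) =
     (\<Sum>T\<in>raw_fillings. list_sign (col mu T 1) * ?P (col mu T))"
  proof -
    have "list_sign (col mu T 1) * ?P (col mu T) = (if T \<in> fillings mu n
       then (-1) ^ ell_first mu T * t ^ inv_stat mu T * (1 - t) ^ des_stat mu T else 0)"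
      if "T \<in> raw_fillings" for T
      unfolding raw_filling_weight[OF that] ell_first_eq[OF that, symmetric] by (simp add: mult.assoc)
    \<comment> \<open>Raw fillings outside \<open>fillings\<close> have weight 0, so the sum may run
      over all raw fillings.\<close>
    then show ?thesis
      unfolding sub using fin by (intro sum.mono_neutral_cong_left) auto
  qed
  also have "\<dots> = (\<Sum>cs\<in>PiE {1..m} arrangements. list_sign (cs 1) * ?P cs * 1)"
  proof -
    have "?P (\<lambda>j\<in>{1..m}. col mu T j) = ?P (col mu T)" for T
      by (intro prod.cong) auto
    then show ?thesis
      using width_pos by (subst sum.reindex_bij_betw[OF raw_fillings_bij, symmetric]) simp
  qed
  also have "\<dots> = (\<Prod>j\<in>{1..<m}. transfer_coeff t (Suc n) (entries j) (entries (Suc j))) *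
      (\<Sum>C\<in>arrangements m. list_sign C * 1)"
    using sum_arrangements[OF assms] width_pos
    by (intro chain_sum[where m = m and h = "\<lambda>_. 1"]) auto
  \<comment> \<open>The last column is a single cell: one arrangement, of sign 1.\<close>
  also have "(\<Sum>C\<in>arrangements m. list_sign C * (1 :: 'a)) = 1"
  proof -
    have "card (entries m) = 1" using card_entries width_pos col_len_last by simp
    then obtain x where "entries m = {x}" by (rule card_1_singletonE)
    then show ?thesis by (simp add: arrangements_def)
  qed
  finally show ?thesis by simp
qed

end


section \<open>The shape obtained by adding the staircase\<close>

lemma eq_atLeastAtMost_if_initial:
  fixes A :: "nat set"
  assumes "finite A" "0 \<notin> A" "\<And>i. Suc i \<in> A \<Longrightarrow> 1 \<le> i \<Longrightarrow> i \<in> A"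
  shows "A = {1..card A}"
proof (cases "A = {}")
  case False
  have down: "i \<in> A" if "k \<in> A" "1 \<le> i" "i \<le> k" for i k
    using that(3,1) by (induction rule: inc_induct) (use that(2) assms(3) in auto)
  have "i \<in> A \<longleftrightarrow> 1 \<le> i \<and> i \<le> Max A" for i
    using down[of "Max A" i] Max_in[OF assms(1) False] Max_ge[OF assms(1), of i] assms(2)
    by (cases i) auto
  then have A: "A = {1..Max A}" by (intro set_eqI) (simp only: atLeastAtMost_iff)
  have "card A = Max A" using arg_cong[OF A, of card] by simp
  then show ?thesis by (simp only:) (rule A)
qed simp

lemma tableau_mu_of:
  assumes n: "2 \<le> n" and lam: "\<forall>i. 1 \<le> i \<and> i < n - 1 \<longrightarrow> lam (Suc i) \<le> lam i"
    and ssyt: "is_ssyt (mu_of n lam) n \<sigma>"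
  shows "tableau (mu_of n lam) n \<sigma>"
proof -
  define mu where "mu = mu_of n lam"
  \<comment> \<open>Adding \<open>\<rho>\<close> makes the nonzero row lengths strictly decreasing,
    so at most one row ends in each column.\<close>
  have dec: "mu (Suc i) < mu i" if "1 \<le> i" "1 \<le> mu (Suc i)" for i
    using that lam[rule_format, of i] by (auto simp: mu_def mu_of_def split: if_splits)
  have mu0: "mu i = 0" if "n \<le> i" for i using that n by (auto simp: mu_def mu_of_def)
  define R where "R j = {i. is_cell mu (i, j)}" for j
  have R: "i \<in> R j \<longleftrightarrow> 1 \<le> i \<and> 1 \<le> j \<and> j \<le> mu i" for i j by (simp add: R_def is_cell_def)
  have fin: "finite (R j)" for j
    by (rule finite_subset[of _ "{..n}"]) (use mu0 R in \<open>fastforce+\<close>)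
  have init: "R j = {1..col_len mu j}" for j
    unfolding col_len_def R_def[symmetric]
  proof (rule eq_atLeastAtMost_if_initial[OF fin])
    fix i assume "Suc i \<in> R j" "1 \<le> i"
    then show "i \<in> R j" using dec[of i] by (auto simp: R)
  qed (simp add: R)
  have cell: "is_cell mu (i, j) \<longleftrightarrow> 1 \<le> i \<and> i \<le> col_len mu j" for i j
    using init[of j] by (auto simp: R_def set_eq_iff)
  have cell': "1 \<le> i \<and> i \<le> col_len mu j \<longleftrightarrow> 1 \<le> i \<and> 1 \<le> j \<and> j \<le> mu i" for i j
    using cell[of i j] by (simp add: is_cell_def)
  have "1 \<le> mu 1" using n by (auto simp: mu_def mu_of_def)
  moreover have "\<not> mu 1 \<le> mu 2"
    using dec[of 1] \<open>1 \<le> mu 1\<close> by (cases "1 \<le> mu 2") (auto simp: numeral_2_eq_2)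
  then have "col_len mu (mu 1) = 1"
    using cell'[of 1 "mu 1"] cell'[of 2 "mu 1"] \<open>1 \<le> mu 1\<close> by simp
  moreover have "is_cell mu (i, j) \<longleftrightarrow> 1 \<le> j \<and> 1 \<le> i \<and> i \<le> col_len mu j" for i j
    using cell[of i j] cell'[of i j] by auto
  moreover have "col_len mu (Suc j) \<le> col_len mu j" if "1 \<le> j" for j
    using cell'[of "col_len mu (Suc j)" "Suc j"] cell'[of "col_len mu (Suc j)" j] that
    by (cases "col_len mu (Suc j) = 0") auto
  moreover have "col_len mu j \<le> Suc (col_len mu (Suc j))" if j: "1 \<le> j" for j
  proof (cases "col_len mu j \<le> 1")
    case False
    then obtain i where i: "col_len mu j = Suc i" "1 \<le> i" by (cases "col_len mu j") auto
    then have "j \<le> mu (Suc i)" using cell'[of "Suc i" j] by simp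
    \<comment> \<open>Row \<open>Suc i\<close> reaches column \<open>j\<close>, so the strictly
      longer row \<open>i\<close> reaches column \<open>Suc j\<close>.\<close>
    then show ?thesis using dec[of i] i j cell'[of i "Suc j"] by simp
  qed auto
  ultimately show ?thesis
    using ssyt unfolding mu_def[symmetric] by unfold_locales auto
qed

theorem theorem4p1:
  fixes n :: nat and lam :: "nat \<Rightarrow> nat" and \<sigma> :: "nat \<times> nat \<Rightarrow> nat"
  assumes "2 \<le> n"
    and "\<forall>i. 1 \<le> i \<and> i < n - 1 \<longrightarrow> lam (Suc i) \<le> lam i"
    and "is_ssyt (mu_of n lam) n \<sigma>"
  shows "let mu = mu_of n lam; m = mu 1; t = [:0, 1::int:]; C = root_col mu \<sigma>;
             LHS = (\<Sum>T \<in> sort_inv mu n \<sigma>.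
                      (-1) ^ ell_first mu T * t ^ inv_stat mu T * (1 - t) ^ des_stat mu T)
         in (if (\<forall>i \<in> {2..m}. non_overlapping (C (i - 1)) (C i))
             then LHS = (- t) ^ (\<Sum>i = 2..m. N_check (C (i - 1)) (C i) + N_hat (C (i - 1)) (C i))
                        * (1 - t) ^ (\<Sum>i = 2..m. p_count (C (i - 1)) (C i))
             else LHS = 0)"
proof -
  interpret tableau "mu_of n lam" n \<sigma>
    using assms by (rule tableau_mu_of)
  define t where "t = [:0, 1::int:]"
  define C where "C = root_col (mu_of n lam) \<sigma>"
  define LHS where "LHS = (\<Sum>T \<in> sort_inv (mu_of n lam) n \<sigma>. (-1) ^ ell_first (mu_of n lam) T *
    t ^ inv_stat (mu_of n lam) T * (1 - t) ^ des_stat (mu_of n lam) T)"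
  let ?nov = "\<lambda>i. non_overlapping (C (i - 1)) (C i)"
  let ?N = "\<lambda>i. N_check (C (i - 1)) (C i) + N_hat (C (i - 1)) (C i)"
  let ?p = "\<lambda>i. p_count (C (i - 1)) (C i)"
  let ?K = "\<lambda>i. if ?nov i then (- t) ^ ?N i * (1 - t) ^ ?p i else 0"
  \<comment> \<open>For the indeterminate this licenses the cancellation of the padding factor
    \<open>1 - t\<close>.\<close>
  have "t \<noteq> 1" by (simp add: t_def one_pCons)
  then have "LHS = (\<Prod>j\<in>{1..<m}. transfer_coeff t (Suc n) (entries j) (entries (Suc j)))"
    unfolding LHS_def by (rule sum_sort_inv)
  also have "\<dots> = (\<Prod>j\<in>{1..<m}. ?K (Suc j))"
    by (intro prod.cong refl, subst transfer_coeff_root) (auto simp: C_def Let_def)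
  also have "\<dots> = prod ?K {2..m}"
    by (rule prod.reindex_bij_witness[of _ "\<lambda>i. i - 1" Suc]) auto
  finally have LHS: "LHS = prod ?K {2..m}" .
  have "if (\<forall>i\<in>{2..m}. ?nov i)
     then LHS = (- t) ^ (\<Sum>i = 2..m. ?N i) * (1 - t) ^ (\<Sum>i = 2..m. ?p i) else LHS = 0"
  proof (cases "\<forall>i\<in>{2..m}. ?nov i")
    case True
    then have "prod ?K {2..m} = (\<Prod>i\<in>{2..m}. (- t) ^ ?N i * (1 - t) ^ ?p i)"
      by (intro prod.cong) auto
    then show ?thesis
      unfolding if_P[OF True] LHS by (simp only: prod.distrib power_sum)
  next
    case False
    then have "prod ?K {2..m} = 0" by (intro prod_zero) auto
    then show ?thesis unfolding if_not_P[OF False] LHS .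
  qed
  then show ?thesis
    unfolding Let_def LHS_def t_def C_def .
qed

end
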